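(* Let $D$ be a marked graph diagram. Define $$S'_D=[D](1,1,0,0).$$ Then $S'_D$ is invariant under all Yoshikawa moves; that is, if $D'$ is obtained from $D$ by any one of the Yoshikawa moves $\Omega_1,\Omega_2,\Omega_3,\Omega_4,\Omega_4',\Omega_5,\Omega_6,\Omega_6',\Omega_7,\Omega_8$ (in either direction), then $S'_{D'}=S'_D$.
   Context: **Marked graph diagrams.** A marked graph diagram $D$ is a link diagram in $\mathbb R^2$ possibly with some $4$-valent marked vertices: a generic planar diagram whose double points are finitely many classical crossings (with over/under information) and finitely many marked vertices. Near a marked vertex the diagram looks like the letter X, and the vertex carries a marker, a short segment through the vertex lying in one pair of opposite sectors of the X. Diagrams are considered up to isotopy of the plane and are unoriented. In pictures, the four arms at a crossing or vertex are called NW, NE, SW, SE; a horizontal marker lies in the left and right sectors, a vertical marker in the upper and lower sectors. **State-sum.** $\widehat D$ is obtained from $D$ by removing all classical crossings (so both strands are cut at each crossing), while marked vertices are not removed (so the four arms at a marked vertex belong to the same component of $\widehat D$). A state is a map $\sigma$ from the set of connected components of $\widehat D$ to $\{0,1\}$. It is legal if at each classical crossing each label occurs an even number of times among the four arm-ends. For a legal state $\sigma$ and a classical crossing $c$, rotate the picture so that the over-strand joins SW and NE. With $a\ne b$ the two labels, $\nu(c,\sigma)$ is: $x$ if all four labels are equal; $y$ if NW$=$SE$=a$ and NE$=$SW$=b$; $z$ if NW$=$NE$=a$ and SW$=$SE$=b$; $w$ if NW$=$SW$=a$ and NE$=$SE$=b$. Then $$[D]=[D](x,y,z,w)=\sum_{\text{legal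 states }\sigma}\ \prod_{\text{classical crossings }c}\nu(c,\sigma)\in\mathbb Z[x,y,z,w].$$ **Yoshikawa moves.** Each move replaces the part of the diagram in a disk by another one with the same boundary points, the rest being unchanged (moves may be used in both directions, up to isotopy of the plane). - $\Omega_1$: a crossing with over-strand SW–NE, whose NE and SE arms are joined by an arc on the right and whose NW and SW arms go to the boundary, $\leftrightarrow$ a simple arc. - $\Omega_2$: two arcs, the left one passing over the right one at two crossings that bound a bigon, $\leftrightarrow$ two disjoint arcs. - $\Omega_3$: two straight strands crossing at a point, the NW–SE strand over the SW–NE strand, and a third, left-to-right, strand $H$ passing over both; $H$ passes below the crossing point (crossing its SW and SE arms) $\leftrightarrow$ $H$ passes above it (crossing the NW and NE arms). - $\Omega_4$: a marked vertex with horizontal marker and a left-to-right strand $H$; $H$ passes over the SW and SE arms $\leftrightarrow$ $H$ passes over the NW and NE arms. - $\Omega_4'$: as $\Omega_4$, but $H$ passes under the arms. - $\Omega_5$: a crossing with over-strand SW–NE on the left and a marked vertex with horizontal marker on the right, with the NE (resp. SE) arm of the crossing joined to the NW (resp. SW) arm of the vertex, the other four arms going to the boundary, $\leftrightarrow$ the marked vertex with horizontal marker on the left and a crossing with over-strand SW–NE on the right, joined in the same way. - $\Omega_6$: a marked vertex with vertical marker whose NE and SE arms are joined by an arc on the right and whose NW and SW arms go to the boundary $\leftrightarrow$ a simple arc. - $\Omega_6'$: as $\Omega_6$, with horizontal marker. - $\Omega_7$: a disk with boundary points $t_1,t_2,t_3$ on top and $b_1,b_2,b_3$ at the bottom (left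 to right), no crossings. One side: a lower-left vertex $v$ with vertical marker and an upper-right vertex $v'$ with horizontal marker; $v$ has SW to $b_1$, NW to $t_1$, SE to $b_2$, NE joined to the SW arm of $v'$; $v'$ has NW to $t_2$, NE to $t_3$, SE to $b_3$. Other side: an upper-left vertex $u$ with vertical marker and a lower-right vertex $u'$ with horizontal marker; $u$ has NW to $t_1$, NE to $t_2$, SW to $b_1$, SE joined to the NW arm of $u'$; $u'$ has SW to $b_2$, SE to $b_3$, NE to $t_3$. - $\Omega_8$: a disk with boundary points $t_1,\dots,t_4$ on top and $b_1,\dots,b_4$ at the bottom. A left vertex $v$ with vertical marker has NW to $t_1$, NE to $t_2$, SW to $b_3$, SE to $b_4$; a right vertex $v'$ with horizontal marker has NW to $t_3$, NE to $t_4$, SW to $b_1$, SE to $b_2$; the two parallel lower arms of $v$ cross the two parallel lower arms of $v'$ in exactly four crossings. On one side the arms of $v'$ are over at all four crossings $\leftrightarrow$ on the other side the arms of $v$ are over at all four crossings. *)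

theory Defs
  imports "HOL-Analysis.Analysis"
begin

text \<open>
  Diagrams are actual subsets of the plane \<open>complex\<close>. Of the sets \<open>over\<close> and \<open>marker\<close> only the
  germs at the classical crossings, respectively at the marked vertices, carry information: near a
  crossing \<open>over\<close> is the over-strand, and near a marked vertex \<open>marker\<close> is the marker.
\<close>

record diagram =
  curve :: "complex set"
  crossings :: "complex set"
  vertices :: "complex set"
  over :: "complex set"
  marker :: "complex set"

definition germ_eq :: "complex \<Rightarrow> complex set \<Rightarrow> complex set \<Rightarrow> bool" where
  "germ_eq p A B \<longleftrightarrow> (\<forall>\<^sub>F z in nhds p. z \<in> A \<longleftrightarrow> z \<in> B)"

definition line :: "complex \<Rightarrow> complex \<Rightarrow> complex set" where
  "line p d = range (\<lambda>t. p + complex_of_real t * d)"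

text \<open>
  \<open>Im (cnj u * v) > 0\<close> says that \<open>(u, v)\<close> is a positively oriented basis of the plane. Rotating the
  over-strand to the position SW--NE, the arms in the directions \<open>u\<close>, \<open>v\<close>, \<open>-u\<close>, \<open>-v\<close> become NE, NW,
  SW, SE, in this order. A crossing determines \<open>u\<close> and \<open>v\<close> up to positive factors and a
  simultaneous change of sign.
\<close>

definition crossing_frame :: "diagram \<Rightarrow> complex \<Rightarrow> complex \<Rightarrow> complex \<Rightarrow> bool" where
  "crossing_frame D c u v \<longleftrightarrow>
     Im (cnj u * v) > 0 \<and>
     germ_eq c (curve D) (line c u \<union> line c v) \<and>
     germ_eq c (over D) (line c u)"

text \<open>
  The direction \<open>u - v\<close> lies between the arms \<open>u\<close> and \<open>-v\<close>; as \<open>u\<close> and \<open>v\<close> may be rescaled, and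
  \<open>(u, v)\<close> replaced by \<open>(v, -u)\<close>, every straight marker in either pair of opposite sectors occurs.
\<close>

definition vertex_frame :: "diagram \<Rightarrow> complex \<Rightarrow> complex \<Rightarrow> complex \<Rightarrow> bool" where
  "vertex_frame D p u v \<longleftrightarrow>
     Im (cnj u * v) > 0 \<and>
     germ_eq p (curve D) (line p u \<union> line p v) \<and>
     germ_eq p (marker D) (line p (u - v))"

text \<open>
  Up to isotopy of the plane the two strands at a double point may be taken to be straight near
  that point; elsewhere the diagram is a topological 1-manifold.
\<close>

definition marked_graph_diagram :: "diagram \<Rightarrow> bool" where
  "marked_graph_diagram D \<longleftrightarrow>
     compact (curve D) \<and>
     finite (crossings D) \<and> finite (vertices D) \<and>
     crossings D \<subseteq> curve D \<and> vertices D \<subseteq> curve D \<and>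
     crossings D \<inter> vertices D = {} \<and>
     (\<forall>c \<in> crossings D. \<exists>u v. crossing_frame D c u v) \<and>
     (\<forall>p \<in> vertices D. \<exists>u v. vertex_frame D p u v) \<and>
     (\<forall>p \<in> curve D - crossings D - vertices D.
        \<exists>U. open U \<and> p \<in> U \<and> (curve D \<inter> U) homeomorphic (UNIV :: real set))"


subsection \<open>The state-sum\<close>

definition hat :: "diagram \<Rightarrow> complex set" where
  "hat D = curve D - crossings D"

definition states :: "diagram \<Rightarrow> (complex set \<Rightarrow> nat) set" where
  "states D = components (hat D) \<rightarrow>\<^sub>E {0, 1}"

definition arm :: "diagram \<Rightarrow> complex \<Rightarrow> complex \<Rightarrow> complex set" where
  "arm D c d = (THE K. K \<in> components (hat D) \<and>
                       (\<forall>\<^sub>F t in at_right 0. c + complex_of_real t * d \<in> K))"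

definition frame :: "diagram \<Rightarrow> complex \<Rightarrow> complex \<times> complex" where
  "frame D c = (SOME (u, v). crossing_frame D c u v)"

definition NE :: "diagram \<Rightarrow> complex \<Rightarrow> complex set" where
  "NE D c = arm D c (fst (frame D c))"
definition NW :: "diagram \<Rightarrow> complex \<Rightarrow> complex set" where
  "NW D c = arm D c (snd (frame D c))"
definition SW :: "diagram \<Rightarrow> complex \<Rightarrow> complex set" where
  "SW D c = arm D c (- fst (frame D c))"
definition SE :: "diagram \<Rightarrow> complex \<Rightarrow> complex set" where
  "SE D c = arm D c (- snd (frame D c))"

definition legal :: "diagram \<Rightarrow> (complex set \<Rightarrow> nat) \<Rightarrow> bool" where
  "legal D \<sigma> \<longleftrightarrow>
     (\<forall>c \<in> crossings D. \<forall>l \<in> {0, 1}.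
        even (count_list [\<sigma> (NW D c), \<sigma> (NE D c), \<sigma> (SW D c), \<sigma> (SE D c)] l))"

text \<open>The last alternative of \<open>weight\<close> does not occur for legal states.\<close>

definition weight ::
  "diagram \<Rightarrow> 'a :: comm_ring_1 \<Rightarrow> 'a \<Rightarrow> 'a \<Rightarrow> 'a \<Rightarrow> complex \<Rightarrow> (complex set \<Rightarrow> nat) \<Rightarrow> 'a" where
  "weight D x y z w c \<sigma> =
     (let nw = \<sigma> (NW D c); ne = \<sigma> (NE D c); sw = \<sigma> (SW D c); se = \<sigma> (SE D c)
      in if nw = ne \<and> ne = sw \<and> sw = se then x
         else if nw = se \<and> ne = sw then y
         else if nw = ne \<and> sw = se then z
         else if nw = sw \<and> ne = se then w
         else 0)"

text \<open>
  The integer polynomial \<open>[D]\<close> in four variables is represented by its values at all quadruples of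
  elements of commutative rings.
\<close>

definition bracket :: "diagram \<Rightarrow> 'a :: comm_ring_1 \<Rightarrow> 'a \<Rightarrow> 'a \<Rightarrow> 'a \<Rightarrow> 'a" where
  "bracket D x y z w =
     (\<Sum>\<sigma> | \<sigma> \<in> states D \<and> legal D \<sigma>. \<Prod>c \<in> crossings D. weight D x y z w c \<sigma>)"

definition S_prime :: "diagram \<Rightarrow> int" where
  "S_prime D = bracket D 1 1 0 0"


subsection \<open>Isotopy of the plane and local replacement\<close>

definition agree_on :: "complex set \<Rightarrow> diagram \<Rightarrow> diagram \<Rightarrow> bool" where
  "agree_on S D E \<longleftrightarrow>
     curve D \<inter> S = curve E \<inter> S \<and>
     crossings D \<inter> S = crossings E \<inter> S \<and>
     vertices D \<inter> S = vertices E \<inter> S \<and>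
     (\<forall>c \<in> crossings D \<inter> S. germ_eq c (over D) (over E)) \<and>
     (\<forall>p \<in> vertices D \<inter> S. germ_eq p (marker D) (marker E))"

definition image_diagram :: "(complex \<Rightarrow> complex) \<Rightarrow> diagram \<Rightarrow> diagram" where
  "image_diagram h D =
     \<lparr>curve = h ` curve D, crossings = h ` crossings D, vertices = h ` vertices D,
      over = h ` over D, marker = h ` marker D\<rparr>"

definition ambient_isotopy :: "(real \<Rightarrow> complex \<Rightarrow> complex) \<Rightarrow> bool" where
  "ambient_isotopy H \<longleftrightarrow>
     continuous_on ({0..1} \<times> UNIV) (\<lambda>(t, z). H t z) \<and>
     (\<forall>t \<in> {0..1}. \<exists>g. homeomorphism UNIV UNIV (H t) g) \<and>
     H 0 = id"

definition isotopic :: "diagram \<Rightarrow> diagram \<Rightarrow> bool" where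
  "isotopic D E \<longleftrightarrow> (\<exists>H. ambient_isotopy H \<and> agree_on UNIV (image_diagram (H 1) D) E)"

text \<open>
  The local pictures are drawn in one fixed square; a picture in any other disk is brought into it
  by an isotopy of the plane.
\<close>

definition disk :: "complex set" where
  "disk = cbox (Complex (-4) (-4)) (Complex 4 4)"

definition replaces :: "diagram \<Rightarrow> diagram \<Rightarrow> diagram \<Rightarrow> diagram \<Rightarrow> bool" where
  "replaces L R D D' \<longleftrightarrow>
     (\<exists>E E'. marked_graph_diagram E \<and> marked_graph_diagram E' \<and>
        isotopic D E \<and> isotopic E' D' \<and>
        agree_on disk E L \<and> agree_on disk E' R \<and> agree_on (- disk) E E')"


subsection \<open>The local pictures of the Yoshikawa moves\<close>

fun polyline :: "(real \<times> real) list \<Rightarrow> complex set" where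
  "polyline ((a, b) # (c, d) # ps) =
     closed_segment (Complex a b) (Complex c d) \<union> polyline ((c, d) # ps)"
| "polyline _ = {}"

definition kink :: "complex set" where
  "kink = polyline [(-4, 2), (2, -1), (2, 1), (-4, -2)]"

definition simple_arc :: diagram where
  "simple_arc =
     \<lparr>curve = polyline [(-4, 2), (2, 0), (-4, -2)],
      crossings = {}, vertices = {}, over = {}, marker = {}\<rparr>"

definition strand_NW_SE :: "complex set" where
  "strand_NW_SE = polyline [(-2, 4), (2, -4)]"
definition strand_SW_NE :: "complex set" where
  "strand_SW_NE = polyline [(-2, -4), (2, 4)]"
definition H_below :: "complex set" where
  "H_below = polyline [(-4, 0), (-3, -2), (3, -2), (4, 0)]"
definition H_above :: "complex set" where
  "H_above = polyline [(-4, 0), (-3, 2), (3, 2), (4, 0)]"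

definition chain :: "complex set" where
  "chain = polyline [(-4, 2), (0, -2), (4, 2)] \<union> polyline [(-4, -2), (0, 2), (4, -2)]"

definition Omega8_curve :: "complex set" where
  "Omega8_curve =
     polyline [(-3, 4), (-3, 3), (-1, 1), (-1, 0), (3, -4)] \<union>
     polyline [(-1, 4), (-1, 3), (-3, 1), (-3, 0), (1, -4)] \<union>
     polyline [(3, 4), (3, 3), (1, 1), (1, 0), (-3, -4)] \<union>
     polyline [(1, 4), (1, 3), (3, 1), (3, 0), (-1, -4)]"

datatype yoshikawa =
  Omega1 | Omega2 | Omega3 | Omega4 | Omega4' | Omega5 | Omega6 | Omega6' | Omega7 | Omega8

fun left_side :: "yoshikawa \<Rightarrow> diagram" where
  "left_side Omega1 =
     \<lparr>curve = kink, crossings = {0}, vertices = {},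
      over = polyline [(-2, -1), (2, 1)], marker = {}\<rparr>"
| "left_side Omega2 =
     \<lparr>curve = polyline [(-2, 4), (2, 0), (-2, -4)] \<union> polyline [(2, 4), (-2, 0), (2, -4)],
      crossings = {Complex 0 2, Complex 0 (-2)}, vertices = {},
      over = polyline [(-2, 4), (2, 0), (-2, -4)], marker = {}\<rparr>"
| "left_side Omega3 =
     \<lparr>curve = strand_NW_SE \<union> strand_SW_NE \<union> H_below,
      crossings = {0, Complex (-1) (-2), Complex 1 (-2)}, vertices = {},
      over = polyline [(-1/2, 1), (1/2, -1)] \<union> H_below, marker = {}\<rparr>"
| "left_side Omega4 =
     \<lparr>curve = strand_NW_SE \<union> strand_SW_NE \<union> H_below,
      crossings = {Complex (-1) (-2), Complex 1 (-2)}, vertices = {0},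
      over = H_below, marker = polyline [(-1/2, 0), (1/2, 0)]\<rparr>"
| "left_side Omega4' =
     \<lparr>curve = strand_NW_SE \<union> strand_SW_NE \<union> H_below,
      crossings = {Complex (-1) (-2), Complex 1 (-2)}, vertices = {0},
      over = strand_NW_SE \<union> strand_SW_NE, marker = polyline [(-1/2, 0), (1/2, 0)]\<rparr>"
| "left_side Omega5 =
     \<lparr>curve = chain, crossings = {Complex (-2) 0}, vertices = {Complex 2 0},
      over = polyline [(-3, -1), (-1, 1)], marker = polyline [(3/2, 0), (5/2, 0)]\<rparr>"
| "left_side Omega6 =
     \<lparr>curve = kink, crossings = {}, vertices = {0},
      over = {}, marker = polyline [(0, -1/2), (0, 1/2)]\<rparr>"
| "left_side Omega6' =
     \<lparr>curve = kink, crossings = {}, vertices = {0},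
      over = {}, marker = polyline [(-1/2, 0), (1/2, 0)]\<rparr>"
| "left_side Omega7 =
     \<lparr>curve = polyline [(-2, -4), (-2, -2), (2, 2), (2, 4)] \<union>
              polyline [(-2, 4), (-2, 0), (0, -2), (0, -4)] \<union>
              polyline [(0, 4), (0, 2), (2, 0), (2, -4)],
      crossings = {}, vertices = {Complex (-1) (-1), Complex 1 1}, over = {},
      marker = polyline [(-1, -3/2), (-1, -1/2)] \<union> polyline [(1/2, 1), (3/2, 1)]\<rparr>"
| "left_side Omega8 =
     \<lparr>curve = Omega8_curve,
      crossings = {Complex 0 (-1), Complex (-1) (-2), Complex 1 (-2), Complex 0 (-3)},
      vertices = {Complex (-2) 2, Complex 2 2},
      over = polyline [(1, 0), (-3, -4)] \<union> polyline [(3, 0), (-1, -4)],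
      marker = polyline [(-2, 3/2), (-2, 5/2)] \<union> polyline [(3/2, 2), (5/2, 2)]\<rparr>"

fun right_side :: "yoshikawa \<Rightarrow> diagram" where
  "right_side Omega1 = simple_arc"
| "right_side Omega2 =
     \<lparr>curve = polyline [(-2, 4), (-2, -4)] \<union> polyline [(2, 4), (2, -4)],
      crossings = {}, vertices = {}, over = {}, marker = {}\<rparr>"
| "right_side Omega3 =
     \<lparr>curve = strand_NW_SE \<union> strand_SW_NE \<union> H_above,
      crossings = {0, Complex (-1) 2, Complex 1 2}, vertices = {},
      over = polyline [(-1/2, 1), (1/2, -1)] \<union> H_above, marker = {}\<rparr>"
| "right_side Omega4 =
     \<lparr>curve = strand_NW_SE \<union> strand_SW_NE \<union> H_above,
      crossings = {Complex (-1) 2, Complex 1 2}, vertices = {0},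
      over = H_above, marker = polyline [(-1/2, 0), (1/2, 0)]\<rparr>"
| "right_side Omega4' =
     \<lparr>curve = strand_NW_SE \<union> strand_SW_NE \<union> H_above,
      crossings = {Complex (-1) 2, Complex 1 2}, vertices = {0},
      over = strand_NW_SE \<union> strand_SW_NE, marker = polyline [(-1/2, 0), (1/2, 0)]\<rparr>"
| "right_side Omega5 =
     \<lparr>curve = chain, crossings = {Complex 2 0}, vertices = {Complex (-2) 0},
      over = polyline [(1, -1), (3, 1)], marker = polyline [(-5/2, 0), (-3/2, 0)]\<rparr>"
| "right_side Omega6 = simple_arc"
| "right_side Omega6' = simple_arc"
| "right_side Omega7 =
     \<lparr>curve = polyline [(-2, 4), (-2, 2), (2, -2), (2, -4)] \<union>
              polyline [(-2, -4), (-2, 0), (0, 2), (0, 4)] \<union>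
              polyline [(0, -4), (0, -2), (2, 0), (2, 4)],
      crossings = {}, vertices = {Complex (-1) 1, Complex 1 (-1)}, over = {},
      marker = polyline [(-1, 1/2), (-1, 3/2)] \<union> polyline [(1/2, -1), (3/2, -1)]\<rparr>"
| "right_side Omega8 =
     \<lparr>curve = Omega8_curve,
      crossings = {Complex 0 (-1), Complex (-1) (-2), Complex 1 (-2), Complex 0 (-3)},
      vertices = {Complex (-2) 2, Complex 2 2},
      over = polyline [(-1, 0), (3, -4)] \<union> polyline [(-3, 0), (1, -4)],
      marker = polyline [(-2, 3/2), (-2, 5/2)] \<union> polyline [(3/2, 2), (5/2, 2)]\<rparr>"

definition yoshikawa_move :: "yoshikawa \<Rightarrow> diagram \<Rightarrow> diagram \<Rightarrow> bool" where
  "yoshikawa_move m D D' \<longleftrightarrow>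
     replaces (left_side m) (right_side m) D D' \<or> replaces (right_side m) (left_side m) D D'"

end

theory Submission
  imports Defs
begin

text \<open>
  At \<open>(1, 1, 0, 0)\<close> the product of the weights of a state is \<open>1\<close> if opposite arms have equal labels
  at every crossing, and \<open>0\<close> otherwise; equal opposite labels make a state legal. So \<open>S_prime D\<close>
  counts the two-colourings of the diagram in which every strand keeps its colour when it passes
  through a crossing. Their number is a power of \<open>2\<close>, whose exponent is the number of components of
  the graph in which strands pass through each other at the crossings and are joined only at the
  marked vertices. None of the moves changes this number.

  To make this precise, a \<open>colouring\<close> is a locally constant two-valued function on \<open>hat D\<close> whose germ
  at each crossing is constant on the over-strand and constant on the rest of the curve. States with
  equal opposite labels are the colourings written in terms of components
  (\<open>S_prime_eq_card_colourings\<close>); this uses that \<open>hat D\<close> is locally connected and has finitely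
  many components. Colourings are carried along by homeomorphisms of the plane
  (\<open>card_colourings_isotopic\<close>), so an isotopy does not change their number.

  For the local replacement, the strands of a local picture fall into classes, where strands that
  meet outside the crossings belong to the same class. A colouring is constant on each class, and any
  choice of constants on the classes is a colouring of the local picture. Hence the colourings of the
  whole diagram are determined by their restrictions to the complement of the open disk, and the
  restrictions that occur depend only on the partition of the boundary points of the disk that the
  classes induce (\<open>card_colourings_local\<close>). It remains to check that the two sides of every move
  induce the same partition (\<open>same_connections\<close>). The pictures consist of straight segments, so
  each check is linear arithmetic in the two coordinates.
\<close>

section \<open>Colourings\<close>

text \<open>
  The condition at a crossing says that colours pass straight through. It is phrased with germs of
  sets instead of frames, so that it makes sense for, and is preserved by, every homeomorphism of the
  plane.
\<close>
definition colouring :: "diagram \<Rightarrow> (complex \<Rightarrow> bool) \<Rightarrow> bool" where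
  "colouring D f \<longleftrightarrow>
     (\<forall>z. f z \<longrightarrow> z \<in> hat D) \<and>
     continuous_on (hat D) f \<and>
     (\<forall>c \<in> crossings D.
        (\<exists>a. \<forall>\<^sub>F z in nhds c. z \<in> hat D \<and> z \<in> over D \<longrightarrow> f z = a) \<and>
        (\<exists>b. \<forall>\<^sub>F z in nhds c. z \<in> hat D \<and> z \<notin> over D \<longrightarrow> f z = b))"

text \<open>
  As \<open>bool\<close> is discrete, continuity means local constancy; this form combines with the other
  \<open>eventually\<close> conditions on germs.
\<close>
lemma continuous_on_bool_iff:
  fixes f :: "'a::topological_space \<Rightarrow> bool"
  shows "continuous_on S f \<longleftrightarrow> (\<forall>z\<in>S. \<forall>\<^sub>F w in nhds z. w \<in> S \<longrightarrow> f w = f z)"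
proof -
  have "eventually (\<lambda>w. f w = f z) (at z within S) \<longleftrightarrow> (\<forall>\<^sub>F w in nhds z. w \<in> S \<longrightarrow> f w = f z)" for z
    unfolding eventually_at_filter by (rule eventually_cong) (auto intro: always_eventually)
  thus ?thesis by (simp add: continuous_on_def tendsto_discrete)
qed

lemma eventually_not_in_finite:
  fixes c :: "'a::t1_space"
  assumes "finite X"
  shows "\<forall>\<^sub>F z in nhds c. z \<in> X \<longrightarrow> z = c"
proof -
  have "closed (X - {c})" using assms by (intro finite_imp_closed) simp
  hence "open (- (X - {c}))" by (rule open_Compl)
  hence "\<forall>\<^sub>F z in nhds c. z \<in> - (X - {c})" by (rule eventually_nhds_in_open) simp
  thus ?thesis by (rule eventually_mono) auto
qed

lemma connected_line_ball:
  "connected (line p d \<inter> ball p e)"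
proof -
  have "convex (line p d)"
  proof -
    have "line p d = (\<lambda>z. p + z) ` ((\<lambda>t. complex_of_real t * d) ` UNIV)"
      by (auto simp: line_def)
    moreover have "linear (\<lambda>t. complex_of_real t * d)"
      by (intro linearI) (auto simp: algebra_simps scaleR_conv_of_real)
    ultimately show ?thesis by (metis convex_UNIV convex_linear_image convex_translation)
  qed
  thus ?thesis by (intro convex_connected convex_Int) auto
qed

section \<open>Components of the cut diagram\<close>

text \<open>
  Near a vertex the curve is a cross of two lines through the vertex. Near any other point of
  \<open>hat D\<close> a chart carries a small interval into the curve, and the finitely many crossings can be
  avoided.
\<close>
lemma hat_connected_neighbourhood:
  assumes "marked_graph_diagram D" "z \<in> hat D"
  obtains U where "open U" "z \<in> U" "connected (hat D \<inter> U)"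
proof -
  have fin: "finite (crossings D)" using assms(1) by (simp add: marked_graph_diagram_def)
  have op: "open (- crossings D)" using fin by (simp add: finite_imp_closed open_Compl)
  have z: "z \<in> curve D" "z \<notin> crossings D" using assms(2) by (auto simp: hat_def)
  show ?thesis
  proof (cases "z \<in> vertices D")
    case True
    then obtain u v where "vertex_frame D z u v"
      using assms(1) by (auto simp: marked_graph_diagram_def)
    hence "\<forall>\<^sub>F w in nhds z. w \<in> curve D \<longleftrightarrow> w \<in> line z u \<union> line z v"
      by (simp add: vertex_frame_def germ_eq_def)
    moreover have "\<forall>\<^sub>F w in nhds z. w \<in> - crossings D"
      using op z by (intro eventually_nhds_in_open) auto
    ultimately have "\<forall>\<^sub>F w in nhds z. w \<in> hat D \<longleftrightarrow> w \<in> line z u \<union> line z v"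
      by eventually_elim (auto simp: hat_def)
    then obtain e where e: "e > 0" "\<And>w. dist w z < e \<Longrightarrow> w \<in> hat D \<longleftrightarrow> w \<in> line z u \<union> line z v"
      by (auto simp: eventually_nhds_metric)
    have "hat D \<inter> ball z e = (line z u \<inter> ball z e) \<union> (line z v \<inter> ball z e)"
      using e(2) by (auto simp: dist_commute)
    moreover have "connected (\<dots>)"
    proof (rule connected_Un[OF connected_line_ball connected_line_ball])
      have "z \<in> line z u" "z \<in> line z v"
        unfolding line_def by (simp_all add: range_eqI[of _ _ "0::real"])
      thus "(line z u \<inter> ball z e) \<inter> (line z v \<inter> ball z e) \<noteq> {}" using e(1) by fastforce
    qed
    ultimately have "connected (hat D \<inter> ball z e)" by simp
    thus ?thesis using that[of "ball z e"] e(1) by auto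
  next
    case False
    then obtain U where U: "open U" "z \<in> U" "(curve D \<inter> U) homeomorphic (UNIV :: real set)"
      using assms(1) z unfolding marked_graph_diagram_def by blast
    then obtain \<phi> \<psi> where h: "homeomorphism (curve D \<inter> U) (UNIV::real set) \<phi> \<psi>"
      by (auto simp: homeomorphic_def)
    (* V is the set of parameters of the chart that do not belong to crossings. *)
    define V where "V = \<psi> -` (- crossings D)"
    have cp: "continuous_on UNIV \<psi>" using h by (rule homeomorphism_cont2)
    have retr: "\<psi> (\<phi> z) = z" using homeomorphism_apply1[OF h] z U by simp
    have "open V" unfolding V_def using op cp by (rule open_vimage)
    moreover have "\<phi> z \<in> V" using retr z by (simp add: V_def)
    ultimately have "\<exists>e>0. ball (\<phi> z) e \<subseteq> V" by (simp add: open_contains_ball)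
    then obtain e where e: "e > 0" "ball (\<phi> z) e \<subseteq> V" by blast
    have "openin (top_of_set (curve D \<inter> U)) (\<psi> ` ball (\<phi> z) e)"
      by (rule homeomorphism_imp_open_map[OF homeomorphism_symD[OF h]]) simp
    then obtain W where W: "open W" "\<psi> ` ball (\<phi> z) e = curve D \<inter> U \<inter> W"
      by (auto simp: openin_open)
    have eq: "hat D \<inter> (U \<inter> W) = \<psi> ` ball (\<phi> z) e"
    proof -
      have "\<psi> ` ball (\<phi> z) e \<subseteq> - crossings D" using e(2) unfolding V_def by blast
      thus ?thesis using W(2) unfolding hat_def by blast
    qed
    have "connected (\<psi> ` ball (\<phi> z) e)"
      by (rule connected_continuous_image)
         (use continuous_on_subset[OF cp] in \<open>simp_all add: convex_connected\<close>)
    moreover have "z \<in> \<psi> ` ball (\<phi> z) e"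
      using retr e(1) by (metis centre_in_ball imageI)
    ultimately show ?thesis using that[of "U \<inter> W"] eq W U by auto
  qed
qed

text \<open>
  Components of \<open>hat D\<close> are relatively open, by local connectedness. Hence a function that is
  constant on each component is continuous.
\<close>
lemma eventually_same_component:
  assumes "marked_graph_diagram D" "K \<in> components (hat D)" "z \<in> K"
  shows "\<forall>\<^sub>F w in nhds z. w \<in> hat D \<longrightarrow> w \<in> K"
proof -
  have "z \<in> hat D" using assms in_components_subset by blast
  then obtain U where U: "open U" "z \<in> U" "connected (hat D \<inter> U)"
    using hat_connected_neighbourhood[OF assms(1)] by blast
  have "hat D \<inter> U \<subseteq> K"
    by (rule components_maximal[OF assms(2) U(3)]) (use U \<open>z \<in> hat D\<close> assms(3) in auto)
  show ?thesis using eventually_nhds_in_open[OF U(1,2)]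
    by eventually_elim (use \<open>hat D \<inter> U \<subseteq> K\<close> in blast)
qed

section \<open>The arms at a crossing\<close>

lemma component_of_connected_subset:
  assumes "connected A" "A \<subseteq> S" "A \<noteq> {}"
  shows "\<exists>K\<in>components S. A \<subseteq> K \<and> (\<forall>K'\<in>components S. A \<inter> K' \<noteq> {} \<longrightarrow> K' = K)"
proof -
  obtain a where a: "a \<in> A" "a \<in> S" using assms by blast
  let ?K = "connected_component_set S a"
  have 1: "?K \<in> components S" using a by (auto simp: components_def)
  have 2: "A \<subseteq> ?K" using connected_component_maximal a assms by blast
  have 3: "K' = ?K" if "K' \<in> components S" "A \<inter> K' \<noteq> {}" for K'
    using components_nonoverlap[OF that(1) 1] that(2) 2 by blast
  show ?thesis by (rule bexI[OF _ 1]) (use 2 3 in auto)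
qed

text \<open>
  A short open segment leaving the crossing is connected, so it lies in one component, and every
  component that contains the segment near its end is this one: the description in \<open>arm\<close> is
  satisfied by exactly one component.
\<close>
lemma arm_segment:
  assumes "d \<noteq> 0" "e > 0" and sub: "\<And>t. 0 < t \<Longrightarrow> t < e \<Longrightarrow> c + complex_of_real t * d \<in> hat D"
  shows "arm D c d \<in> components (hat D)"
    and "\<And>t. 0 < t \<Longrightarrow> t < e \<Longrightarrow> c + complex_of_real t * d \<in> arm D c d"
proof -
  define A where "A = (\<lambda>t. c + complex_of_real t * d) ` {0<..<e}"
  have "connected A" unfolding A_def
    by (intro connected_continuous_image continuous_intros) auto
  moreover have "A \<subseteq> hat D" using sub by (auto simp: A_def)
  moreover have "A \<noteq> {}" using assms(2) by (simp add: A_def)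
  ultimately obtain K where K: "K \<in> components (hat D)" "A \<subseteq> K"
     "\<forall>K'\<in>components (hat D). A \<inter> K' \<noteq> {} \<longrightarrow> K' = K"
    using component_of_connected_subset[of A "hat D"] by blast
  have ev: "\<forall>\<^sub>F t in at_right 0. 0 < t \<and> t < e"
    unfolding eventually_at_right_field using assms(2) by auto
  have inK: "c + complex_of_real t * d \<in> K" if "0 < t" "t < e" for t
    using K(2) that by (auto simp: A_def image_subset_iff)
  have "arm D c d = K"
    unfolding arm_def
  proof (rule the_equality)
    show "K \<in> components (hat D) \<and> (\<forall>\<^sub>F t in at_right 0. c + complex_of_real t * d \<in> K)"
      using K(1) ev by (auto elim!: eventually_mono intro: inK)
  next
    fix K' assume K': "K' \<in> components (hat D) \<and> (\<forall>\<^sub>F t in at_right 0. c + complex_of_real t * d \<in> K')"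
    hence "\<forall>\<^sub>F t in at_right 0. 0 < t \<and> t < e \<and> c + complex_of_real t * d \<in> K'"
      using ev by (auto elim: eventually_elim2)
    then obtain t where "0 < t" "t < e" "c + complex_of_real t * d \<in> K'"
      using eventually_happens'[OF trivial_limit_at_right_real] by blast
    moreover have "c + complex_of_real t * d \<in> A"
      unfolding A_def using \<open>0 < t\<close> \<open>t < e\<close> by (intro imageI) simp
    ultimately have "A \<inter> K' \<noteq> {}" by blast
    thus "K' = K" using K(3) K' by blast
  qed
  thus "arm D c d \<in> components (hat D)"
    and "\<And>t. 0 < t \<Longrightarrow> t < e \<Longrightarrow> c + complex_of_real t * d \<in> arm D c d"
    using K(1) inK by auto
qed

text \<open>
  In a small ball around a crossing the curve consists of four radii, two of them on the over-strand.
  This collects what is needed about them: each radius lies in the component called its arm, and every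
  nearby point of \<open>hat D\<close> lies in one of the two arms of its strand.
\<close>
lemma crossing_arms:
  assumes D: "marked_graph_diagram D" and c: "c \<in> crossings D" and fr: "crossing_frame D c u v"
  shows "\<And>d. d \<in> {u, v, -u, -v} \<Longrightarrow> arm D c d \<in> components (hat D)"
    and "\<And>d. d \<in> {u, v, -u, -v} \<Longrightarrow> \<forall>\<^sub>F t in at_right 0. c + complex_of_real t * d \<in> arm D c d"
    and "\<And>d. d \<in> {u, -u} \<Longrightarrow> \<forall>\<^sub>F t in at_right 0. c + complex_of_real t * d \<in> over D"
    and "\<And>d. d \<in> {v, -v} \<Longrightarrow> \<forall>\<^sub>F t in at_right 0. c + complex_of_real t * d \<notin> over D"
    and "\<forall>\<^sub>F z in nhds c. z \<in> hat D \<and> z \<in> over D \<longrightarrow> z \<in> arm D c u \<union> arm D c (-u)"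
    and "\<forall>\<^sub>F z in nhds c. z \<in> hat D \<and> z \<notin> over D \<longrightarrow> z \<in> arm D c v \<union> arm D c (-v)"
proof -
  have pos: "Im (cnj u * v) > 0" using fr by (simp add: crossing_frame_def)
  hence nz: "u \<noteq> 0" "v \<noteq> 0" by auto
  have "\<forall>\<^sub>F z in nhds c. (z \<in> curve D \<longleftrightarrow> z \<in> line c u \<union> line c v) \<and>
          (z \<in> over D \<longleftrightarrow> z \<in> line c u) \<and> (z \<in> crossings D \<longrightarrow> z = c)"
    using fr D unfolding crossing_frame_def germ_eq_def marked_graph_diagram_def
    by (auto intro!: eventually_conj eventually_not_in_finite)
  then obtain r where r: "r > 0" "\<And>z. dist z c < r \<Longrightarrow> (z \<in> curve D \<longleftrightarrow> z \<in> line c u \<union> line c v)"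
     "\<And>z. dist z c < r \<Longrightarrow> (z \<in> over D \<longleftrightarrow> z \<in> line c u)"
     "\<And>z. dist z c < r \<Longrightarrow> z \<in> crossings D \<Longrightarrow> z = c"
    unfolding eventually_nhds_metric by blast
  (* On both lines, parameters below e give points within distance r. *)
  define e where "e = r / max (norm u) (norm v)"
  have mx: "max (norm u) (norm v) > 0" using nz by (auto simp: less_max_iff_disj)
  have e: "e > 0" using r(1) mx by (simp add: e_def)
  have near: "dist (c + complex_of_real t * d) c < r" if "d \<in> {u, v, -u, -v}" "0 < t" "t < e" for t d
  proof -
    have "norm d \<le> max (norm u) (norm v)" using that(1) by auto
    hence "t * norm d \<le> t * max (norm u) (norm v)" using that(2) by (simp add: mult_left_mono)
    also have "\<dots> < r" using that(3) mx by (simp add: e_def field_simps)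
    finally show ?thesis using that by (simp add: dist_norm norm_mult)
  qed
  (* The frame is a basis, so the two lines meet only at the crossing. *)
  have vu: "c + complex_of_real t * v \<notin> line c u" if "t \<noteq> 0" for t
  proof
    assume "c + complex_of_real t * v \<in> line c u"
    then obtain s where "c + complex_of_real t * v = c + complex_of_real s * u"
      unfolding line_def by (elim rangeE)
    hence "complex_of_real t * v = complex_of_real s * u" by simp
    hence "Im (cnj u * (complex_of_real t * v)) = Im (cnj u * (complex_of_real s * u))" by simp
    hence "t * Im (cnj u * v) = 0" by (simp add: algebra_simps)
    thus False using that pos by simp
  qed
  have ln: "c + complex_of_real t * u \<in> line c u" "c + complex_of_real t * v \<in> line c v" 
      "c + complex_of_real t * - u \<in> line c u" "c + complex_of_real t * - v \<in> line c v" for t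
    unfolding line_def by (auto intro: range_eqI[where x="-t"])
  have nc: "c + complex_of_real t * d \<noteq> c" if "d \<in> {u, v, -u, -v}" "0 < t" for t d
    using that nz by auto
  have inhat: "c + complex_of_real t * d \<in> hat D" if "d \<in> {u, v, -u, -v}" "0 < t" "t < e" for t d
    using r(2)[OF near[OF that]] r(4)[OF near[OF that]] nc[OF that(1,2)] ln[of t] that(1)
    by (auto simp: hat_def)
  have nzd: "d \<noteq> 0" if "d \<in> {u, v, -u, -v}" for d using that nz by auto
  show A1: "\<And>d. d \<in> {u, v, -u, -v} \<Longrightarrow> arm D c d \<in> components (hat D)"
    by (rule arm_segment(1)[OF nzd e inhat])
  have A2: "\<And>d t. d \<in> {u, v, -u, -v} \<Longrightarrow> 0 < t \<Longrightarrow> t < e \<Longrightarrow> c + complex_of_real t * d \<in> arm D c d"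
    by (rule arm_segment(2)[OF nzd e inhat])
  have ev: "\<forall>\<^sub>F t in at_right 0. 0 < t \<and> t < e"
    unfolding eventually_at_right_field using e by auto
  show "\<And>d. d \<in> {u, v, -u, -v} \<Longrightarrow> \<forall>\<^sub>F t in at_right 0. c + complex_of_real t * d \<in> arm D c d"
    using A2 ev by (auto elim!: eventually_mono)
  show "\<forall>\<^sub>F t in at_right 0. c + complex_of_real t * d \<in> over D" if "d \<in> {u, -u}" for d
    using ev
  proof eventually_elim
    case (elim t)
    have "dist (c + complex_of_real t * d) c < r" using near[of d t] that elim by auto
    thus ?case using r(3) ln[of t] that by auto
  qed
  show "\<forall>\<^sub>F t in at_right 0. c + complex_of_real t * d \<notin> over D" if "d \<in> {v, -v}" for d
    using ev
  proof eventually_elim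
    case (elim t)
    have "dist (c + complex_of_real t * d) c < r" using near[of d t] that elim by auto
    thus ?case using r(3) vu[of t] vu[of "-t"] that elim by auto
  qed
  (* On both lines, points within distance q have parameters below e. *)
  define q where "q = e * min (norm u) (norm v)"
  have q: "q > 0" using e nz by (simp add: q_def)
  have "e * norm u \<le> r" "e * norm v \<le> r"
    using mx r(1) by (auto simp: e_def divide_le_eq mult_left_mono)
  hence qr: "q \<le> r" using e by (auto simp: q_def min_def)
  have key: "z \<in> arm D c d \<union> arm D c (-d)" if d: "d \<in> {u, v}" and z: "dist z c < q" "z \<in> line c d" "z \<noteq> c" for z d
  proof -
    obtain t where t: "z = c + complex_of_real t * d" using z(2) by (auto simp: line_def)
    have t0: "t \<noteq> 0" using t z(3) by auto
    have "\<bar>t\<bar> * norm d < e * min (norm u) (norm v)" using z(1) t by (simp add: dist_norm norm_mult q_def)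
    also have "\<dots> \<le> e * norm d" using d e by auto
    finally have te: "\<bar>t\<bar> < e" using d nz by auto
    show ?thesis
    proof (cases "t > 0")
      case True thus ?thesis using A2[of d t] te t d by auto
    next
      case False thus ?thesis using A2[of "-d" "-t"] te t t0 d by auto
    qed
  qed
  show "\<forall>\<^sub>F z in nhds c. z \<in> hat D \<and> z \<in> over D \<longrightarrow> z \<in> arm D c u \<union> arm D c (-u)"
    unfolding eventually_nhds_metric
  proof (intro exI conjI allI impI)
    show "q > 0" by (rule q)
    fix z assume "dist z c < q" "z \<in> hat D \<and> z \<in> over D"
    thus "z \<in> arm D c u \<union> arm D c (-u)" using key[of u z] r(3)[of z] qr c by (auto simp: hat_def)
  qed
  show "\<forall>\<^sub>F z in nhds c. z \<in> hat D \<and> z \<notin> over D \<longrightarrow> z \<in> arm D c v \<union> arm D c (-v)"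
    unfolding eventually_nhds_metric
  proof (intro exI conjI allI impI)
    show "q > 0" by (rule q)
    fix z assume "dist z c < q" "z \<in> hat D \<and> z \<notin> over D"
    thus "z \<in> arm D c v \<union> arm D c (-v)" using key[of v z] r(2,3)[of z] qr c by (auto simp: hat_def)
  qed
qed

text \<open>
  Every point of the compact curve has a neighbourhood that meets at most four components of
  \<open>hat D\<close>: one at a point of \<open>hat D\<close>, and the four arms at a crossing.
\<close>
lemma finite_components_hat:
  assumes D: "marked_graph_diagram D"
  shows "finite (components (hat D))"
proof -
  let ?C = "components (hat D)"
  have loc: "\<exists>U. open U \<and> p \<in> U \<and> finite {K \<in> ?C. K \<inter> U \<noteq> {}}" if p: "p \<in> curve D" for p
  proof -
    have "\<exists>F. finite F \<and> F \<subseteq> ?C \<and> (\<forall>\<^sub>F z in nhds p. z \<in> hat D \<longrightarrow> z \<in> \<Union>F)"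
    proof (cases "p \<in> crossings D")
      case True
      then obtain u v where fr: "crossing_frame D p u v"
        using D by (auto simp: marked_graph_diagram_def)
      note ca = crossing_arms[OF D True fr]
      have "\<forall>\<^sub>F z in nhds p. z \<in> hat D \<longrightarrow> z \<in> \<Union>(arm D p ` {u, v, -u, -v})"
        using ca(5,6) by eventually_elim auto
      thus ?thesis using ca(1) by (intro exI[of _ "arm D p ` {u, v, -u, -v}"]) auto
    next
      case False
      hence "p \<in> hat D" using p by (simp add: hat_def)
      then obtain K where "K \<in> ?C" "p \<in> K" using Union_components by blast
      thus ?thesis using eventually_same_component[OF D] by (intro exI[of _ "{K}"]) auto
    qed
    then obtain F U where F: "finite F" "F \<subseteq> ?C" and U: "open U" "p \<in> U" "\<forall>z\<in>U. z \<in> hat D \<longrightarrow> z \<in> \<Union>F"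
      by (auto simp: eventually_nhds)
    have "{K \<in> ?C. K \<inter> U \<noteq> {}} \<subseteq> F"
    proof
      fix K assume "K \<in> {K \<in> ?C. K \<inter> U \<noteq> {}}"
      hence K: "K \<in> ?C" "K \<inter> U \<noteq> {}" by auto
      then obtain z where z: "z \<in> K" "z \<in> U" by blast
      hence "z \<in> hat D" using K in_components_subset by blast
      then obtain K' where "K' \<in> F" "z \<in> K'" using U z by blast
      thus "K \<in> F" using components_nonoverlap[OF K(1), of K'] F(2) z by auto
    qed
    thus ?thesis using U F finite_subset by blast
  qed
  hence "\<forall>p\<in>curve D. \<exists>U. open U \<and> p \<in> U \<and> finite {K \<in> ?C. K \<inter> U \<noteq> {}}" by blast
  from bchoice[OF this] obtain U where
    U: "\<forall>p\<in>curve D. open (U p) \<and> p \<in> U p \<and> finite {K \<in> ?C. K \<inter> U p \<noteq> {}}" by blast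
  have "compact (curve D)" using D by (simp add: marked_graph_diagram_def)
  moreover have "\<And>p. p \<in> curve D \<Longrightarrow> open (U p)" "curve D \<subseteq> (\<Union>p\<in>curve D. U p)"
    using U by blast+
  ultimately obtain P where P: "P \<subseteq> curve D" "finite P" "curve D \<subseteq> (\<Union>p\<in>P. U p)"
    by (rule compactE_image)
  have "?C \<subseteq> (\<Union>p\<in>P. {K \<in> ?C. K \<inter> U p \<noteq> {}})"
  proof
    fix K assume K: "K \<in> ?C"
    then obtain z where "z \<in> K" using in_components_nonempty by blast
    moreover have "z \<in> curve D" using calculation in_components_subset[OF K] by (auto simp: hat_def)
    ultimately show "K \<in> (\<Union>p\<in>P. {K \<in> ?C. K \<inter> U p \<noteq> {}})" using P(3) K by blast
  qed
  thus ?thesis by (rule finite_subset) (use P U in auto)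
qed

section \<open>The state-sum counts colourings\<close>

text \<open>
  These are the states that contribute to \<open>S_prime\<close>.
\<close>
definition through_states :: "diagram \<Rightarrow> (complex set \<Rightarrow> nat) set" where
  "through_states D =
     {\<sigma> \<in> states D. \<forall>c \<in> crossings D. \<sigma> (NE D c) = \<sigma> (SW D c) \<and> \<sigma> (NW D c) = \<sigma> (SE D c)}"

lemma weight_1_1_0_0:
  "weight D 1 1 0 0 c \<sigma> =
     (if \<sigma> (NE D c) = \<sigma> (SW D c) \<and> \<sigma> (NW D c) = \<sigma> (SE D c) then 1 else (0::int))"
proof -
  have "(if nw = ne \<and> ne = sw \<and> sw = se then 1 else if nw = se \<and> ne = sw then 1
         else if nw = ne \<and> sw = se then 0 else if nw = sw \<and> ne = se then 0 else 0)
      = (if ne = sw \<and> nw = se then 1 else (0::int))" for nw ne sw se :: nat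
    by presburger
  thus ?thesis unfolding weight_def Let_def .
qed

lemma S_prime_eq_card_through_states:
  assumes D: "marked_graph_diagram D"
  shows "S_prime D = int (card (through_states D))"
proof -
  define ok where "ok = (\<lambda>\<sigma> :: complex set \<Rightarrow> nat.
    \<forall>c\<in>crossings D. \<sigma> (NE D c) = \<sigma> (SW D c) \<and> \<sigma> (NW D c) = \<sigma> (SE D c))"
  have fin: "finite (states D)" unfolding states_def
    by (rule finite_PiE[OF finite_components_hat[OF D]]) simp
  have finc: "finite (crossings D)" using D by (simp add: marked_graph_diagram_def)
  have prod: "(\<Prod>c\<in>crossings D. weight D 1 1 0 0 c \<sigma>) = (if ok \<sigma> then 1 else (0::int))" for \<sigma>
    unfolding weight_1_1_0_0 ok_def using finc by (auto simp: prod_zero_iff)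
  have leg: "legal D \<sigma>" if "ok \<sigma>" for \<sigma>
    using that unfolding ok_def by (simp add: legal_def)
  have "S_prime D = (\<Sum>\<sigma> | \<sigma> \<in> states D \<and> legal D \<sigma>. if ok \<sigma> then 1 else 0)"
    unfolding S_prime_def bracket_def prod ..
  also have "\<dots> = (\<Sum>\<sigma> | \<sigma> \<in> states D \<and> ok \<sigma>. 1)"
  proof (rule sum.mono_neutral_cong_right)
    show "finite {\<sigma> \<in> states D. legal D \<sigma>}" using fin by simp
    show "{\<sigma> \<in> states D. ok \<sigma>} \<subseteq> {\<sigma> \<in> states D. legal D \<sigma>}" using leg by blast
  qed simp_all
  finally show ?thesis by (simp add: through_states_def ok_def)
qed

lemma crossing_frame_frame:
  assumes "marked_graph_diagram D" "c \<in> crossings D"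
  shows "crossing_frame D c (fst (frame D c)) (snd (frame D c))"
proof -
  have "\<exists>p. case p of (u, v) \<Rightarrow> crossing_frame D c u v"
    using assms by (auto simp: marked_graph_diagram_def)
  from someI_ex[OF this] have "case_prod (crossing_frame D c) (frame D c)"
    by (simp only: frame_def)
  thus ?thesis by (simp add: case_prod_beta)
qed

definition lift_state :: "diagram \<Rightarrow> (complex set \<Rightarrow> nat) \<Rightarrow> complex \<Rightarrow> bool" where
  "lift_state D \<sigma> z \<longleftrightarrow> z \<in> hat D \<and> \<sigma> (connected_component_set (hat D) z) = 1"

lemma lift_state_component:
  assumes "K \<in> components (hat D)" "z \<in> K"
  shows "lift_state D \<sigma> z \<longleftrightarrow> \<sigma> K = 1"
proof -
  obtain x where "K = connected_component_set (hat D) x" using assms(1) unfolding components_iff by blast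
  hence "connected_component_set (hat D) z = K" using assms(2) connected_component_eq by metis
  moreover have "z \<in> hat D" using assms in_components_subset by blast
  ultimately show ?thesis by (simp add: lift_state_def)
qed

text \<open>
  Near \<open>c\<close> the predicate \<open>P\<close> singles out one strand, with arms \<open>K\<close> and \<open>K'\<close>. Both arms come
  arbitrarily close to \<open>c\<close>, so the germ of \<open>f\<close> is constant on the strand only if \<open>f\<close> takes the
  same value on both.
\<close>
lemma constant_germ_iff:
  assumes "K \<in> components (hat D)" "K' \<in> components (hat D)"
    and near: "\<forall>\<^sub>F z in nhds c. z \<in> hat D \<and> P z \<longrightarrow> z \<in> K \<union> K'"
    and d: "\<forall>\<^sub>F t in at_right 0. c + complex_of_real t * d \<in> K" "\<forall>\<^sub>F t in at_right 0. P (c + complex_of_real t * d)"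
    and d': "\<forall>\<^sub>F t in at_right 0. c + complex_of_real t * d' \<in> K'" "\<forall>\<^sub>F t in at_right 0. P (c + complex_of_real t * d')"
    and val: "\<And>z. z \<in> K \<Longrightarrow> f z = a" "\<And>z. z \<in> K' \<Longrightarrow> f z = a'"
  shows "(\<exists>b. \<forall>\<^sub>F z in nhds c. z \<in> hat D \<and> P z \<longrightarrow> f z = b) \<longleftrightarrow> a = a'"
proof
  assume "a = a'"
  have "\<forall>\<^sub>F z in nhds c. z \<in> hat D \<and> P z \<longrightarrow> f z = a"
    using near by eventually_elim (use val \<open>a = a'\<close> in auto)
  thus "\<exists>b. \<forall>\<^sub>F z in nhds c. z \<in> hat D \<and> P z \<longrightarrow> f z = b" by blast
next
  assume "\<exists>b. \<forall>\<^sub>F z in nhds c. z \<in> hat D \<and> P z \<longrightarrow> f z = b"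
  then obtain b where b: "\<forall>\<^sub>F z in nhds c. z \<in> hat D \<and> P z \<longrightarrow> f z = b" by blast
  have lim: "filterlim (\<lambda>t. c + complex_of_real t * d) (nhds c) (at_right 0)" for d
    by (rule tendsto_eq_intros refl | simp)+
  have *: "a = b" if "K \<in> components (hat D)" "\<forall>\<^sub>F t in at_right 0. c + complex_of_real t * d \<in> K" "\<forall>\<^sub>F t in at_right 0. P (c + complex_of_real t * d)"
    "\<And>z. z \<in> K \<Longrightarrow> f z = a" for K d a
  proof -
    have "\<forall>\<^sub>F t in at_right 0. c + complex_of_real t * d \<in> K \<and> f (c + complex_of_real t * d) = b"
      using eventually_compose_filterlim[OF b lim[of d]] that(2,3)
      by eventually_elim (use that(1) in_components_subset in blast)
    then obtain t where "c + complex_of_real t * d \<in> K" "f (c + complex_of_real t * d) = b"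
      using eventually_happens'[OF trivial_limit_at_right_real] by blast
    thus ?thesis using that(4) by blast
  qed
  show "a = a'" using *[OF assms(1) d val(1)] *[OF assms(2) d' val(2)] by simp
qed

lemma crossing_condition_iff:
  assumes D: "marked_graph_diagram D" and c: "c \<in> crossings D"
    and \<sigma>: "\<And>K z. K \<in> components (hat D) \<Longrightarrow> z \<in> K \<Longrightarrow> f z \<longleftrightarrow> \<sigma> K = (1::nat)"
    and bin: "\<And>K. K \<in> components (hat D) \<Longrightarrow> \<sigma> K \<in> {0, 1}"
  shows "(\<exists>a. \<forall>\<^sub>F z in nhds c. z \<in> hat D \<and> z \<in> over D \<longrightarrow> f z = a) \<longleftrightarrow> \<sigma> (NE D c) = \<sigma> (SW D c)"
    and "(\<exists>b. \<forall>\<^sub>F z in nhds c. z \<in> hat D \<and> z \<notin> over D \<longrightarrow> f z = b) \<longleftrightarrow> \<sigma> (NW D c) = \<sigma> (SE D c)"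
proof -
  note ca = crossing_arms[OF D c crossing_frame_frame[OF D c]]
  have eq: "(\<sigma> K = 1) = (\<sigma> K' = 1) \<longleftrightarrow> \<sigma> K = \<sigma> K'" if "K \<in> components (hat D)" "K' \<in> components (hat D)" for K K'
    using bin[OF that(1)] bin[OF that(2)] by auto
  show "(\<exists>a. \<forall>\<^sub>F z in nhds c. z \<in> hat D \<and> z \<in> over D \<longrightarrow> f z = a) \<longleftrightarrow> \<sigma> (NE D c) = \<sigma> (SW D c)"
    unfolding NE_def SW_def
    by (subst constant_germ_iff[OF ca(1) ca(1) ca(5) ca(2) ca(3) ca(2) ca(3) \<sigma> \<sigma>])
       (use ca(1) eq in auto)
  show "(\<exists>b. \<forall>\<^sub>F z in nhds c. z \<in> hat D \<and> z \<notin> over D \<longrightarrow> f z = b) \<longleftrightarrow> \<sigma> (NW D c) = \<sigma> (SE D c)"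
    unfolding NW_def SE_def
    by (subst constant_germ_iff[OF ca(1) ca(1) ca(6) ca(2) ca(4) ca(2) ca(4) \<sigma> \<sigma>])
       (use ca(1) eq in auto)
qed

text \<open>
  A state is a function of components, a colouring the corresponding function of points; the
  conditions at the crossings match by \<open>crossing_condition_iff\<close>.
\<close>
lemma bij_betw_lift_state:
  assumes D: "marked_graph_diagram D"
  shows "bij_betw (lift_state D) (through_states D) {f. colouring D f}"
  unfolding bij_betw_def
proof (intro conjI set_eqI iffI)
  show "inj_on (lift_state D) (through_states D)"
  proof (rule inj_onI)
    fix \<sigma> \<tau> assume s: "\<sigma> \<in> through_states D" "\<tau> \<in> through_states D" and eq: "lift_state D \<sigma> = lift_state D \<tau>"
    show "\<sigma> = \<tau>"
    proof (rule PiE_ext)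
      show "\<sigma> \<in> components (hat D) \<rightarrow>\<^sub>E {0, 1}" "\<tau> \<in> components (hat D) \<rightarrow>\<^sub>E {0, 1}"
        using s by (auto simp: through_states_def states_def)
      fix K assume K: "K \<in> components (hat D)"
      then obtain z where "z \<in> K" using in_components_nonempty by blast
      hence "\<sigma> K = 1 \<longleftrightarrow> \<tau> K = 1" using lift_state_component[OF K] eq by metis
      moreover have "\<sigma> K \<in> {0,1}" "\<tau> K \<in> {0,1}" using s K by (auto simp: through_states_def states_def)
      ultimately show "\<sigma> K = \<tau> K" by auto
    qed
  qed
next
  fix f assume "f \<in> lift_state D ` through_states D"
  then obtain \<sigma> where \<sigma>: "\<sigma> \<in> through_states D" and f: "f = lift_state D \<sigma>" by blast
  have val: "f z \<longleftrightarrow> \<sigma> K = 1" if "K \<in> components (hat D)" "z \<in> K" for K z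
    using lift_state_component[OF that] f by simp
  have bin: "\<sigma> K \<in> {0, 1}" if "K \<in> components (hat D)" for K
    using \<sigma> that by (auto simp: through_states_def states_def)
  have "continuous_on (hat D) f"
    unfolding continuous_on_bool_iff
  proof
    fix z assume "z \<in> hat D"
    then obtain K where K: "K \<in> components (hat D)" "z \<in> K" using Union_components by blast
    show "\<forall>\<^sub>F w in nhds z. w \<in> hat D \<longrightarrow> f w = f z"
      using eventually_same_component[OF D K] by eventually_elim (use val K in blast)
  qed
  moreover have "\<forall>z. f z \<longrightarrow> z \<in> hat D" by (simp add: f lift_state_def)
  ultimately show "f \<in> {f. colouring D f}"
    using \<sigma> by (auto simp: colouring_def crossing_condition_iff[OF D _ val bin] through_states_def)
next
  fix f assume "f \<in> {f. colouring D f}"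
  hence f: "colouring D f" by simp
  define \<sigma> where "\<sigma> = (\<lambda>K\<in>components (hat D). of_bool (\<exists>z\<in>K. f z) :: nat)"
  have val: "f z \<longleftrightarrow> \<sigma> K = 1" if K: "K \<in> components (hat D)" "z \<in> K" for K z
  proof -
    have "continuous_on K f" using f K in_components_subset continuous_on_subset
      by (metis colouring_def)
    then obtain a where "\<forall>w\<in>K. f w = a"
      using connectedD_const[OF in_components_connected[OF K(1)]] by blast
    thus ?thesis using K by (auto simp: \<sigma>_def)
  qed
  have bin: "\<sigma> K \<in> {0, 1}" if "K \<in> components (hat D)" for K
    using that by (auto simp: \<sigma>_def)
  have "f = lift_state D \<sigma>"
  proof
    fix z show "f z = lift_state D \<sigma> z"
    proof (cases "z \<in> hat D")
      case True
      then obtain K where K: "K \<in> components (hat D)" "z \<in> K" using Union_components by blast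
      thus ?thesis using val lift_state_component by blast
    next
      case False thus ?thesis using f by (auto simp: colouring_def lift_state_def)
    qed
  qed
  moreover have "\<sigma> \<in> through_states D"
    using f crossing_condition_iff[OF D _ val bin]
    by (auto simp: through_states_def states_def colouring_def \<sigma>_def)
  ultimately show "f \<in> lift_state D ` through_states D" by blast
qed

theorem S_prime_eq_card_colourings:
  assumes "marked_graph_diagram D"
  shows "S_prime D = int (card {f. colouring D f})"
  using S_prime_eq_card_through_states[OF assms] bij_betw_same_card[OF bij_betw_lift_state[OF assms]]
  by simp

section \<open>Isotopy invariance\<close>

text \<open>
  All parts of the definition of \<open>colouring\<close> are topological, so precomposition with the inverse
  homeomorphism carries colourings to colourings.
\<close>
lemma colouring_image:
  assumes h: "homeomorphism UNIV UNIV h g" and f: "colouring D f"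
  shows "colouring (image_diagram h D) (f \<circ> g)"
proof -
  have gh: "g (h z) = z" "h (g z) = z" for z
    using h by (auto simp: homeomorphism_def)
  have mem: "z \<in> h ` A \<longleftrightarrow> g z \<in> A" for z A
    using gh by (metis imageE imageI)
  have hat: "z \<in> hat (image_diagram h D) \<longleftrightarrow> g z \<in> hat D" for z
    by (simp add: hat_def image_diagram_def mem)
  have over: "z \<in> over (image_diagram h D) \<longleftrightarrow> g z \<in> over D" for z
    by (simp add: image_diagram_def mem)
  have cg: "continuous_on UNIV g" using h by (simp add: homeomorphism_def)
  have lim: "filterlim g (nhds (g c)) (nhds c)" for c
    using cg by (simp add: continuous_on_eq_continuous_at isCont_def tendsto_at_iff_tendsto_nhds)
  have cont: "continuous_on (hat (image_diagram h D)) (f \<circ> g)"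
  proof (rule continuous_on_compose)
    show "continuous_on (hat (image_diagram h D)) g" using cg continuous_on_subset by blast
    have "g ` hat (image_diagram h D) \<subseteq> hat D" using hat by auto
    thus "continuous_on (g ` hat (image_diagram h D)) f"
      using f continuous_on_subset unfolding colouring_def by blast
  qed
  have cr: "(\<exists>a. \<forall>\<^sub>F z in nhds c. z \<in> hat (image_diagram h D) \<and> z \<in> over (image_diagram h D) \<longrightarrow> (f \<circ> g) z = a) \<and>
            (\<exists>b. \<forall>\<^sub>F z in nhds c. z \<in> hat (image_diagram h D) \<and> z \<notin> over (image_diagram h D) \<longrightarrow> (f \<circ> g) z = b)"
    if "c \<in> crossings (image_diagram h D)" for c
  proof -
    have "g c \<in> crossings D" using that by (simp add: image_diagram_def mem)
    then obtain a b where
      a: "\<forall>\<^sub>F z in nhds (g c). z \<in> hat D \<and> z \<in> over D \<longrightarrow> f z = a" and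
      b: "\<forall>\<^sub>F z in nhds (g c). z \<in> hat D \<and> z \<notin> over D \<longrightarrow> f z = b"
      using f unfolding colouring_def by blast
    show ?thesis
      using eventually_compose_filterlim[OF a lim] eventually_compose_filterlim[OF b lim]
      by (auto simp: hat over)
  qed
  show ?thesis
    unfolding colouring_def using f cont cr hat by (auto simp: colouring_def)
qed

lemma card_colourings_image:
  assumes h: "homeomorphism UNIV UNIV h g"
  shows "card {f. colouring (image_diagram h D) f} = card {f. colouring D f}"
proof -
  have gh: "g \<circ> h = id" "h \<circ> g = id" 
    using h by (auto simp: homeomorphism_def)
  have inv: "image_diagram g (image_diagram h D) = D"
    using gh(1) by (simp add: image_diagram_def image_comp)
  have "bij_betw (\<lambda>f. f \<circ> g) {f. colouring D f} {f. colouring (image_diagram h D) f}"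
  proof (rule bij_betw_byWitness[where f' = "\<lambda>f. f \<circ> h"])
    show "\<forall>f\<in>{f. colouring D f}. f \<circ> g \<circ> h = f"
      by (simp add: comp_assoc gh)
    show "\<forall>f\<in>{f. colouring (image_diagram h D) f}. f \<circ> h \<circ> g = f"
      by (simp add: comp_assoc gh)
    show "(\<lambda>f. f \<circ> g) ` {f. colouring D f} \<subseteq> {f. colouring (image_diagram h D) f}"
      using colouring_image[OF h] by auto
    show "(\<lambda>f. f \<circ> h) ` {f. colouring (image_diagram h D) f} \<subseteq> {f. colouring D f}"
      using colouring_image[OF homeomorphism_symD[OF h], of "image_diagram h D"] inv by auto
  qed
  thus ?thesis using bij_betw_same_card by fastforce
qed

lemma colouring_agree:
  assumes "agree_on UNIV D E" "colouring D f"
  shows "colouring E f"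
proof -
  have eq: "curve D = curve E" "crossings D = crossings E"
    using assms(1) by (auto simp: agree_on_def)
  hence hat: "hat D = hat E" by (simp add: hat_def)
  have "(\<exists>a. \<forall>\<^sub>F z in nhds c. z \<in> hat E \<and> z \<in> over E \<longrightarrow> f z = a) \<and>
        (\<exists>b. \<forall>\<^sub>F z in nhds c. z \<in> hat E \<and> z \<notin> over E \<longrightarrow> f z = b)"
    if c: "c \<in> crossings E" for c
  proof -
    have over: "\<forall>\<^sub>F z in nhds c. z \<in> over D \<longleftrightarrow> z \<in> over E"
      using assms(1) c eq by (simp add: agree_on_def germ_eq_def)
    obtain a b where
      "\<forall>\<^sub>F z in nhds c. z \<in> hat D \<and> z \<in> over D \<longrightarrow> f z = a"
      "\<forall>\<^sub>F z in nhds c. z \<in> hat D \<and> z \<notin> over D \<longrightarrow> f z = b"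
      using assms(2) c eq unfolding colouring_def by blast
    hence "\<forall>\<^sub>F z in nhds c. z \<in> hat E \<and> z \<in> over E \<longrightarrow> f z = a"
      "\<forall>\<^sub>F z in nhds c. z \<in> hat E \<and> z \<notin> over E \<longrightarrow> f z = b"
      using over unfolding hat by (eventually_elim, blast)+
    thus ?thesis by blast
  qed
  thus ?thesis using assms(2) hat by (simp add: colouring_def)
qed

lemma agree_on_sym: "agree_on S D E \<Longrightarrow> agree_on S E D"
  unfolding agree_on_def germ_eq_def by (auto simp: eq_commute)

lemma card_colourings_isotopic:
  assumes "isotopic D E"
  shows "card {f. colouring D f} = card {f. colouring E f}"
proof -
  obtain H where H: "ambient_isotopy H" "agree_on UNIV (image_diagram (H 1) D) E"
    using assms by (auto simp: isotopic_def)
  then obtain g where "homeomorphism UNIV UNIV (H 1) g"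
    by (force simp: ambient_isotopy_def)
  hence "card {f. colouring D f} = card {f. colouring (image_diagram (H 1) D) f}"
    using card_colourings_image by metis
  also have "{f. colouring (image_diagram (H 1) D) f} = {f. colouring E f}"
    using colouring_agree[OF H(2)] colouring_agree[OF agree_on_sym[OF H(2)]] by blast
  finally show ?thesis .
qed

section \<open>Local replacement\<close>

text \<open>
  The crossings of the local pictures lie in the open disk. A crossing of a diagram is therefore
  either in this open set or in the open complement of \<open>disk\<close>, and its germ is affected by only
  one of the two parts.
\<close>
definition disk_interior :: "complex set" where
  "disk_interior = box (Complex (-4) (-4)) (Complex 4 4)"

lemma disk_interior_subset: "disk_interior \<subseteq> disk"
  by (simp add: disk_interior_def disk_def box_subset_cbox)

lemma open_disk_interior: "open disk_interior"
  by (simp add: disk_interior_def open_box)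

lemma open_outside: "open (- disk)"
  by (simp add: disk_def open_Compl closed_cbox)

text \<open>
  Colours do not change along a connected set that passes through each of its crossings on one strand
  only: giving each crossing the common colour of the germ on that strand extends the colouring to
  a continuous function on the whole set. A set that passes through a crossing on both strands may
  carry two colours there, so a kink has to be cut into pieces first.
\<close>
lemma colouring_constant_on_connected:
  assumes fin: "finite (crossings D)" and f: "colouring D f"
    and S: "connected S" "S \<subseteq> curve D"
    and cr: "\<And>c. c \<in> crossings D \<Longrightarrow> c \<in> S \<Longrightarrow>
        (\<forall>\<^sub>F z in nhds c. z \<in> S \<and> z \<noteq> c \<longrightarrow> z \<in> over D) \<or>
        (\<forall>\<^sub>F z in nhds c. z \<in> S \<and> z \<noteq> c \<longrightarrow> z \<notin> over D)"
  shows "\<exists>a. \<forall>z \<in> S - crossings D. f z = a"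
proof -
  have notcr: "\<forall>\<^sub>F z in nhds c. z \<in> crossings D \<longrightarrow> z = c" for c
    using eventually_not_in_finite[OF fin] .
  have "\<exists>a. \<forall>\<^sub>F z in nhds c. z \<in> S \<and> z \<noteq> c \<longrightarrow> f z = a" if c: "c \<in> crossings D" "c \<in> S" for c
  proof -
    have hat: "\<forall>\<^sub>F z in nhds c. z \<in> S \<and> z \<noteq> c \<longrightarrow> z \<in> hat D"
      using notcr[of c] by eventually_elim (use S(2) in \<open>auto simp: hat_def\<close>)
    obtain a b where
      a: "\<forall>\<^sub>F z in nhds c. z \<in> hat D \<and> z \<in> over D \<longrightarrow> f z = a" and
      b: "\<forall>\<^sub>F z in nhds c. z \<in> hat D \<and> z \<notin> over D \<longrightarrow> f z = b"
      using f c unfolding colouring_def by blast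
    from cr[OF c] show ?thesis
    proof
      assume "\<forall>\<^sub>F z in nhds c. z \<in> S \<and> z \<noteq> c \<longrightarrow> z \<in> over D"
      with a hat have "\<forall>\<^sub>F z in nhds c. z \<in> S \<and> z \<noteq> c \<longrightarrow> f z = a" by eventually_elim blast
      thus ?thesis by blast
    next
      assume "\<forall>\<^sub>F z in nhds c. z \<in> S \<and> z \<noteq> c \<longrightarrow> z \<notin> over D"
      with b hat have "\<forall>\<^sub>F z in nhds c. z \<in> S \<and> z \<noteq> c \<longrightarrow> f z = b" by eventually_elim blast
      thus ?thesis by blast
    qed
  qed
  then obtain lim where lim: "\<And>c. c \<in> crossings D \<Longrightarrow> c \<in> S \<Longrightarrow>
      \<forall>\<^sub>F z in nhds c. z \<in> S \<and> z \<noteq> c \<longrightarrow> f z = lim c" by metis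
  define g where "g z = (if z \<in> crossings D then lim z else f z)" for z
  have "continuous_on S g"
    unfolding continuous_on_bool_iff
  proof
    fix z assume z: "z \<in> S"
    show "\<forall>\<^sub>F w in nhds z. w \<in> S \<longrightarrow> g w = g z"
    proof (cases "z \<in> crossings D")
      case True
      show ?thesis using lim[OF True z] notcr[of z]
        by eventually_elim (use True in \<open>auto simp: g_def\<close>)
    next
      case False
      hence zh: "z \<in> hat D" using z S(2) by (auto simp: hat_def)
      have "\<forall>\<^sub>F w in nhds z. w \<in> hat D \<longrightarrow> f w = f z"
        using f zh unfolding colouring_def continuous_on_bool_iff by blast
      thus ?thesis using notcr[of z]
        by eventually_elim (use False S(2) in \<open>auto simp: g_def hat_def\<close>)
    qed
  qed
  then obtain a where "\<forall>z\<in>S. g z = a" using connectedD_const[OF S(1)] by blast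
  hence "\<forall>z\<in>S - crossings D. f z = a" by (auto simp: g_def)
  thus ?thesis by blast
qed

definition strands_at :: "diagram \<Rightarrow> complex \<Rightarrow> complex set \<Rightarrow> complex set \<Rightarrow> bool" where
  "strands_at L c S T \<longleftrightarrow>
     (\<forall>\<^sub>F z in nhds c. z \<noteq> c \<longrightarrow> (z \<in> S \<longleftrightarrow> z \<in> curve L \<and> z \<in> over L) \<and>
                                    (z \<in> T \<longleftrightarrow> z \<in> curve L \<and> z \<notin> over L))"

text \<open>
  The local picture \<open>L\<close> is drawn as a union of connected strands, sorted into classes \<open>P\<close>. Strands
  of different classes meet only at crossings. Within a class all strands meet one of them, the hub,
  at a point that is not a crossing, which forces them to have one colour. Every class reaches the
  boundary of the disk, so that this colour is visible from outside.
\<close>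
definition resolution :: "diagram \<Rightarrow> complex set set set \<Rightarrow> bool" where
  "resolution L \<P> \<longleftrightarrow>
     finite \<P> \<and> (\<forall>P \<in> \<P>. finite P) \<and>
     (\<forall>P \<in> \<P>. \<forall>S \<in> P. connected S \<and> closed S) \<and>
     \<Union>(\<Union>\<P>) = curve L \<and> curve L \<subseteq> disk \<and> crossings L \<subseteq> disk_interior \<and>
     (\<forall>P \<in> \<P>. \<forall>Q \<in> \<P>. P \<noteq> Q \<longrightarrow> \<Union>P \<inter> \<Union>Q \<subseteq> crossings L) \<and>
     (\<forall>P \<in> \<P>. \<not> \<Union>P \<subseteq> disk_interior) \<and>
     (\<forall>P \<in> \<P>. \<exists>S \<in> P. \<forall>T \<in> P. T \<noteq> S \<longrightarrow> \<not> S \<inter> T \<subseteq> crossings L) \<and>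
     (\<forall>c \<in> crossings L. \<exists>S \<in> \<Union>\<P>. \<exists>T \<in> \<Union>\<P>. strands_at L c S T \<and> (\<forall>R \<in> \<Union>\<P>. c \<in> R \<longrightarrow> R = S \<or> R = T))"

lemma
  assumes "resolution L \<P>"
  shows resolution_finite: "finite \<P>"
    and resolution_closed: "P \<in> \<P> \<Longrightarrow> closed (\<Union>P)"
    and resolution_connected: "P \<in> \<P> \<Longrightarrow> S \<in> P \<Longrightarrow> connected S"
    and resolution_subset: "P \<in> \<P> \<Longrightarrow> \<Union>P \<subseteq> curve L"
    and resolution_cover: "curve L = (\<Union>P\<in>\<P>. \<Union>P)"
    and resolution_disk: "curve L \<subseteq> disk"
    and resolution_crossings: "crossings L \<subseteq> disk_interior"
proof -
  note r = assms[unfolded resolution_def]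
  show "finite \<P>" "curve L \<subseteq> disk" "crossings L \<subseteq> disk_interior" using r by simp_all
  have "curve L = \<Union>(\<Union>\<P>)" using r by simp
  also have "\<dots> = (\<Union>P\<in>\<P>. \<Union>P)" by blast
  finally show cover: "curve L = (\<Union>P\<in>\<P>. \<Union>P)" .
  show "closed (\<Union>P)" if "P \<in> \<P>"
    by (rule closed_Union) (use r that in simp_all)
  show "connected S" if "P \<in> \<P>" "S \<in> P" using r that by simp
  show "\<Union>P \<subseteq> curve L" if "P \<in> \<P>" using that cover by blast
qed

lemma resolution_unique:
  assumes "resolution L \<P>" "P \<in> \<P>" "Q \<in> \<P>" "z \<in> \<Union>P" "z \<in> \<Union>Q" "z \<notin> crossings L"
  shows "P = Q"
proof (rule ccontr)
  assume "P \<noteq> Q"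
  hence "\<Union>P \<inter> \<Union>Q \<subseteq> crossings L" using assms(1-3) by (simp add: resolution_def)
  thus False using assms(4-6) by blast
qed

lemma resolution_reaches_rim:
  assumes "resolution L \<P>" "P \<in> \<P>"
  obtains b where "b \<in> \<Union>P" "b \<notin> disk_interior"
proof -
  have "\<not> \<Union>P \<subseteq> disk_interior" using assms by (simp add: resolution_def)
  thus ?thesis using that by blast
qed

lemma resolution_hub:
  assumes "resolution L \<P>" "P \<in> \<P>"
  obtains S where "S \<in> P" "\<And>T. T \<in> P \<Longrightarrow> T \<noteq> S \<Longrightarrow> \<exists>w. w \<in> S \<and> w \<in> T \<and> w \<notin> crossings L"
proof -
  have "\<exists>S \<in> P. \<forall>T \<in> P. T \<noteq> S \<longrightarrow> \<not> S \<inter> T \<subseteq> crossings L" using assms by (simp add: resolution_def)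
  then obtain S where "S \<in> P" and S: "\<forall>T \<in> P. T \<noteq> S \<longrightarrow> \<not> S \<inter> T \<subseteq> crossings L" by blast
  have "\<exists>w. w \<in> S \<and> w \<in> T \<and> w \<notin> crossings L" if "T \<in> P" "T \<noteq> S" for T
    using S that by blast
  thus ?thesis using that[OF \<open>S \<in> P\<close>] by blast
qed

lemma resolution_strands_at:
  assumes "resolution L \<P>" "c \<in> crossings L"
  obtains P Q S T where "P \<in> \<P>" "Q \<in> \<P>" "S \<in> P" "T \<in> Q" "strands_at L c S T"
    "\<And>P R. P \<in> \<P> \<Longrightarrow> R \<in> P \<Longrightarrow> c \<in> R \<Longrightarrow> R = S \<or> R = T"
proof -
  have "\<exists>S \<in> \<Union>\<P>. \<exists>T \<in> \<Union>\<P>. strands_at L c S T \<and> (\<forall>R \<in> \<Union>\<P>. c \<in> R \<longrightarrow> R = S \<or> R = T)"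
    using assms unfolding resolution_def by simp
  then obtain S T where ST: "S \<in> \<Union>\<P>" "T \<in> \<Union>\<P>" "strands_at L c S T"
    and only: "\<forall>R \<in> \<Union>\<P>. c \<in> R \<longrightarrow> R = S \<or> R = T" by blast
  obtain P Q where PQ: "P \<in> \<P>" "S \<in> P" "Q \<in> \<P>" "T \<in> Q" using ST(1,2) by blast
  have "R = S \<or> R = T" if "P \<in> \<P>" "R \<in> P" "c \<in> R" for P R
    using only that by blast
  thus ?thesis using that[OF PQ(1,3,2,4) ST(3)] by blast
qed

lemma agree_on_disk_resolution:
  assumes "agree_on disk E L" "resolution L \<P>"
  shows "curve E \<inter> disk = curve L" "crossings E \<inter> disk = crossings L"
    and "\<And>c. c \<in> crossings L \<Longrightarrow> \<forall>\<^sub>F z in nhds c. z \<in> over E \<longleftrightarrow> z \<in> over L"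
proof -
  have "crossings L \<subseteq> disk" "curve L \<subseteq> disk"
    using resolution_crossings[OF assms(2)] resolution_disk[OF assms(2)] disk_interior_subset by auto
  thus "curve E \<inter> disk = curve L" and cr: "crossings E \<inter> disk = crossings L"
    using assms(1) by (auto simp: agree_on_def)
  fix c assume "c \<in> crossings L"
  hence "c \<in> crossings E \<inter> disk" using cr by simp
  thus "\<forall>\<^sub>F z in nhds c. z \<in> over E \<longleftrightarrow> z \<in> over L"
    using assms(1) unfolding agree_on_def germ_eq_def by blast
qed

text \<open>
  The colour is constant on each strand, and passes from the hub to the other strands at points that
  are not crossings.
\<close>
lemma resolution_constant:
  assumes res: "resolution L \<P>" and agree: "agree_on disk E L"
    and fin: "finite (crossings E)" and f: "colouring E f" and P: "P \<in> \<P>"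
  shows "\<exists>a. \<forall>z \<in> \<Union>P - crossings E. f z = a"
proof -
  note ag = agree_on_disk_resolution[OF agree res]
  have sub: "\<Union>P \<subseteq> curve L" by (rule resolution_subset[OF res P])
  have "\<exists>a. \<forall>z \<in> S - crossings E. f z = a" if S: "S \<in> P" for S
  proof (rule colouring_constant_on_connected[OF fin f])
    show "connected S" by (rule resolution_connected[OF res P S])
    show "S \<subseteq> curve E" using sub S ag(1) by blast
    fix c assume c: "c \<in> crossings E" "c \<in> S"
    have "c \<in> disk" using c(2) S sub resolution_disk[OF res] by blast
    hence cL: "c \<in> crossings L" using c ag(2) by blast
    then obtain U V where U: "strands_at L c U V" and SUV: "S = U \<or> S = V"
      using resolution_strands_at[OF res cL] P S c(2) by metis
    have "\<forall>\<^sub>F z in nhds c. z \<in> U \<and> z \<noteq> c \<longrightarrow> z \<in> over E"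
      using U[unfolded strands_at_def] ag(3)[OF cL] by eventually_elim blast
    moreover have "\<forall>\<^sub>F z in nhds c. z \<in> V \<and> z \<noteq> c \<longrightarrow> z \<notin> over E"
      using U[unfolded strands_at_def] ag(3)[OF cL] by eventually_elim blast
    ultimately show "(\<forall>\<^sub>F z in nhds c. z \<in> S \<and> z \<noteq> c \<longrightarrow> z \<in> over E) \<or>
        (\<forall>\<^sub>F z in nhds c. z \<in> S \<and> z \<noteq> c \<longrightarrow> z \<notin> over E)" using SUV by blast
  qed
  hence "\<forall>S\<in>P. \<exists>a. \<forall>z \<in> S - crossings E. f z = a" by blast
  from bchoice[OF this] obtain val where val: "\<forall>S\<in>P. \<forall>z \<in> S - crossings E. f z = val S" by blast
  obtain S where S: "S \<in> P"
    "\<And>T. T \<in> P \<Longrightarrow> T \<noteq> S \<Longrightarrow> \<exists>w. w \<in> S \<and> w \<in> T \<and> w \<notin> crossings L"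
    using resolution_hub[OF res P] by blast
  have "f z = val S" if z: "z \<in> \<Union>P - crossings E" for z
  proof -
    obtain T where T: "T \<in> P" "z \<in> T" using z by blast
    have fz: "f z = val T" using val T z by blast
    show ?thesis
    proof (cases "T = S")
      case False
      obtain w where w: "w \<in> S" "w \<in> T" "w \<notin> crossings L" using S(2)[OF T(1) False] by blast
      have "w \<in> disk" using w(1) S(1) sub resolution_disk[OF res] by blast
      hence "w \<notin> crossings E" using w(3) ag(2) by blast
      hence "f w = val S" "f w = val T" using val w S(1) T(1) by blast+
      thus ?thesis using fz by simp
    qed (use fz in simp)
  qed
  thus ?thesis by blast
qed

text \<open>
  Equal partitions have equal unions, so the two diagrams have the same points on the boundary of
  the disk.
\<close>
lemma resolution_traces_hat:
  assumes L: "resolution L \<P>" "agree_on disk E L"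
    and R: "resolution R \<Q>" "agree_on disk E' R"
    and out: "agree_on (- disk) E E'"
    and traces: "(\<lambda>P. \<Union>P - disk_interior) ` \<P> = (\<lambda>Q. \<Union>Q - disk_interior) ` \<Q>"
  shows "hat E - disk_interior = hat E' - disk_interior"
proof -
  note aL = agree_on_disk_resolution[OF L(2,1)] and aR = agree_on_disk_resolution[OF R(2,1)]
  have "curve L - disk_interior = \<Union>((\<lambda>P. \<Union>P - disk_interior) ` \<P>)"
    unfolding resolution_cover[OF L(1)] by blast
  also have "\<dots> = curve R - disk_interior"
    unfolding traces resolution_cover[OF R(1)] by blast
  finally have LR: "curve L - disk_interior = curve R - disk_interior" .
  have cr: "crossings L \<subseteq> disk_interior" "crossings R \<subseteq> disk_interior"
    using resolution_crossings L(1) R(1) by blast+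
  show ?thesis
  proof (rule set_eqI)
    fix z
    show "z \<in> hat E - disk_interior \<longleftrightarrow> z \<in> hat E' - disk_interior"
    proof (cases "z \<in> disk")
      case True
      have "z \<in> hat E - disk_interior \<longleftrightarrow> z \<in> curve L - disk_interior"
        using True aL(1,2) cr(1) unfolding hat_def by blast
      moreover have "z \<in> hat E' - disk_interior \<longleftrightarrow> z \<in> curve R - disk_interior"
        using True aR(1,2) cr(2) unfolding hat_def by blast
      ultimately show ?thesis using LR by simp
    next
      case False
      have "curve E \<inter> - disk = curve E' \<inter> - disk" "crossings E \<inter> - disk = crossings E' \<inter> - disk"
        using out by (simp_all add: agree_on_def)
      hence "z \<in> hat E \<longleftrightarrow> z \<in> hat E'" using False unfolding hat_def by blast
      thus ?thesis by simp
    qed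
  qed
qed

text \<open>
  Keep the colouring outside the open disk and give each class of the new picture the colour of its
  boundary points. These have only one colour, because they are the boundary points of a class of
  the old picture. The new function is continuous since the curve is covered by finitely many closed
  sets, the classes and the outer part, on each of which it is locally constant, with equal values
  on the common points.
\<close>
lemma colouring_transfer:
  assumes L: "resolution L \<P>" "agree_on disk E L" "finite (crossings E)"
    and R: "resolution R \<Q>" "agree_on disk E' R"
    and out: "agree_on (- disk) E E'"
    and traces: "(\<lambda>P. \<Union>P - disk_interior) ` \<P> = (\<lambda>Q. \<Union>Q - disk_interior) ` \<Q>"
    and f: "colouring E f"
  shows "\<exists>f'. colouring E' f' \<and> (\<forall>z. z \<notin> disk_interior \<longrightarrow> f' z = f z)"
proof -
  note aL = agree_on_disk_resolution[OF L(2,1)] and aR = agree_on_disk_resolution[OF R(2,1)]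
  have hat: "hat E - disk_interior = hat E' - disk_interior"
    by (rule resolution_traces_hat[OF L(1,2) R out traces])
  have fE: "f z \<Longrightarrow> z \<in> hat E" "continuous_on (hat E) f" for z
    using f unfolding colouring_def by simp_all
  define val where "val Q \<longleftrightarrow> (\<exists>z \<in> \<Union>Q - disk_interior. f z)" for Q
  have val: "f z = val Q" if Q: "Q \<in> \<Q>" "z \<in> \<Union>Q - disk_interior" for Q z
  proof -
    have "\<Union>Q - disk_interior \<in> (\<lambda>P. \<Union>P - disk_interior) ` \<P>" unfolding traces using Q(1) by simp
    then obtain P where P: "P \<in> \<P>" "\<Union>P - disk_interior = \<Union>Q - disk_interior" by (auto simp only: image_iff)
    obtain a where a: "\<forall>w \<in> \<Union>P - crossings E. f w = a"
      using resolution_constant[OF L(1,2,3) f P(1)] by blast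
    have "\<Union>P \<subseteq> disk" using resolution_subset[OF L(1) P(1)] resolution_disk[OF L(1)] by blast
    hence "(\<Union>P - disk_interior) \<inter> crossings E = {}"
      using aL(2) resolution_crossings[OF L(1)] by blast
    hence "f w = a" if "w \<in> \<Union>Q - disk_interior" for w using a that P(2) by blast
    thus ?thesis using Q(2) unfolding val_def by blast
  qed
  define f' where "f' z \<longleftrightarrow> (if z \<in> disk_interior then z \<notin> crossings E' \<and> (\<exists>Q \<in> \<Q>. z \<in> \<Union>Q \<and> val Q) else f z)" for z
  have f'_in: "z \<in> disk_interior \<Longrightarrow> f' z \<longleftrightarrow> z \<notin> crossings E' \<and> (\<exists>Q \<in> \<Q>. z \<in> \<Union>Q \<and> val Q)"
    and f'_out: "z \<notin> disk_interior \<Longrightarrow> f' z = f z" for z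
    by (simp_all add: f'_def)
  have f'val: "f' z = val Q" if Q: "Q \<in> \<Q>" "z \<in> \<Union>Q" "z \<notin> crossings E'" for Q z
  proof (cases "z \<in> disk_interior")
    case True
    have "z \<notin> crossings R" using Q(3) aR(2) by blast
    hence "Q' = Q" if "Q' \<in> \<Q>" "z \<in> \<Union>Q'" for Q'
      using resolution_unique[OF R(1) that(1) Q(1) that(2) Q(2)] by blast
    thus ?thesis unfolding f'_in[OF True] using Q by blast
  next
    case False
    hence "z \<in> \<Union>Q - disk_interior" using Q(2) by blast
    thus ?thesis unfolding f'_out[OF False] by (rule val[OF Q(1)])
  qed
  have cover: "\<exists>Q\<in>\<Q>. w \<in> \<Union>Q" if "w \<in> hat E'" "w \<in> disk" for w
  proof -
    have "w \<in> curve R" using that aR(1) unfolding hat_def by blast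
    thus ?thesis unfolding resolution_cover[OF R(1)] by blast
  qed
  have supp: "z \<in> hat E'" if f'z: "f' z" for z
  proof (cases "z \<in> disk_interior")
    case True
    then obtain Q where Q: "Q \<in> \<Q>" "z \<in> \<Union>Q" "z \<notin> crossings E'" using f'z f'_in by blast
    have "z \<in> curve R" using Q(1,2) resolution_subset[OF R(1)] by blast
    thus ?thesis using Q(3) aR(1) unfolding hat_def by blast
  next
    case False
    hence "z \<in> hat E" using f'z fE(1) f'_out by blast
    thus ?thesis using hat False by blast
  qed
  have cont: "continuous_on (hat E') f'"
    unfolding continuous_on_bool_iff
  proof
    fix z assume z: "z \<in> hat E'"
    (* A point near z lies only in classes that contain z, and it lies in the open disk if z does. *)
    have "\<forall>\<^sub>F w in nhds z. z \<notin> \<Union>Q \<longrightarrow> w \<in> - \<Union>Q" if Q: "Q \<in> \<Q>" for Q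
    proof (cases "z \<in> \<Union>Q")
      case False
      have "open (- \<Union>Q)" by (rule open_Compl[OF resolution_closed[OF R(1) Q]])
      hence "\<forall>\<^sub>F w in nhds z. w \<in> - \<Union>Q"
        by (rule eventually_nhds_in_open) (use False in simp)
      thus ?thesis by eventually_elim blast
    qed simp
    hence "\<forall>Q\<in>\<Q>. \<forall>\<^sub>F w in nhds z. z \<notin> \<Union>Q \<longrightarrow> w \<in> - \<Union>Q" by blast
    hence "\<forall>\<^sub>F w in nhds z. \<forall>Q\<in>\<Q>. z \<notin> \<Union>Q \<longrightarrow> w \<in> - \<Union>Q"
      using resolution_finite[OF R(1)] by (intro eventually_ball_finite)
    moreover have "\<forall>\<^sub>F w in nhds z. z \<in> disk_interior \<longrightarrow> w \<in> disk_interior"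
      using eventually_nhds_in_open[OF open_disk_interior] by (cases "z \<in> disk_interior") simp_all
    moreover have "\<forall>\<^sub>F w in nhds z. z \<notin> disk_interior \<longrightarrow> w \<in> hat E \<longrightarrow> f w = f z"
    proof (cases "z \<in> disk_interior")
      case False
      hence "z \<in> hat E" using z hat by blast
      hence "\<forall>\<^sub>F w in nhds z. w \<in> hat E \<longrightarrow> f w = f z"
        using fE(2) unfolding continuous_on_bool_iff by blast
      thus ?thesis by eventually_elim blast
    qed simp
    ultimately show "\<forall>\<^sub>F w in nhds z. w \<in> hat E' \<longrightarrow> f' w = f' z"
    proof eventually_elim
      case (elim w)
      show ?case
      proof
        assume w: "w \<in> hat E'"
        show "f' w = f' z"
        proof (cases "w \<in> disk")
          case True
          then obtain Q where Q: "Q \<in> \<Q>" "w \<in> \<Union>Q" using cover[OF w] by blast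
          moreover have "z \<in> \<Union>Q" using elim(1) Q by blast
          moreover have "w \<notin> crossings E'" "z \<notin> crossings E'" using w z by (simp_all add: hat_def)
          ultimately show ?thesis using f'val[OF Q(1)] by blast
        next
          case False
          hence w_out: "w \<notin> disk_interior" using disk_interior_subset by blast
          hence z_out: "z \<notin> disk_interior" using elim(2) by blast
          have "w \<in> hat E" using w w_out hat by blast
          thus ?thesis using elim(3) w_out z_out f'_out by blast
        qed
      qed
    qed
  qed
  have cr: "(\<exists>a. \<forall>\<^sub>F z in nhds c. z \<in> hat E' \<and> z \<in> over E' \<longrightarrow> f' z = a) \<and>
            (\<exists>b. \<forall>\<^sub>F z in nhds c. z \<in> hat E' \<and> z \<notin> over E' \<longrightarrow> f' z = b)"
    if c: "c \<in> crossings E'" for c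
  proof (cases "c \<in> disk")
    case True
    hence cR: "c \<in> crossings R" using c aR(2) by blast
    obtain P Q S T where
      P: "P \<in> \<Q>" "S \<in> P" and Q: "Q \<in> \<Q>" "T \<in> Q" and ST: "strands_at R c S T"
      using resolution_strands_at[OF R(1) cR] by metis
    have "c \<in> disk_interior" using cR resolution_crossings[OF R(1)] by blast
    hence ins: "\<forall>\<^sub>F z in nhds c. z \<in> disk_interior" by (rule eventually_nhds_in_open[OF open_disk_interior])
    have hat_R: "z \<in> curve R" if "z \<in> disk_interior" "z \<in> hat E'" for z
      using that aR(1) disk_interior_subset unfolding hat_def by blast
    have "\<forall>\<^sub>F z in nhds c. z \<in> hat E' \<and> z \<in> over E' \<longrightarrow> f' z = val P"
      using ins ST[unfolded strands_at_def] aR(3)[OF cR]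
    proof eventually_elim
      case (elim z)
      show ?case
      proof
        assume z: "z \<in> hat E' \<and> z \<in> over E'"
        hence nc: "z \<noteq> c" "z \<notin> crossings E'" using c unfolding hat_def by blast+
        have "z \<in> S" using elim z nc(1) hat_R by blast
        hence "z \<in> \<Union>P" using P(2) by blast
        thus "f' z = val P" by (rule f'val[OF P(1) _ nc(2)])
      qed
    qed
    moreover have "\<forall>\<^sub>F z in nhds c. z \<in> hat E' \<and> z \<notin> over E' \<longrightarrow> f' z = val Q"
      using ins ST[unfolded strands_at_def] aR(3)[OF cR]
    proof eventually_elim
      case (elim z)
      show ?case
      proof
        assume z: "z \<in> hat E' \<and> z \<notin> over E'"
        hence nc: "z \<noteq> c" "z \<notin> crossings E'" using c unfolding hat_def by blast+
        have "z \<in> T" using elim z nc(1) hat_R by blast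
        hence "z \<in> \<Union>Q" using Q(2) by blast
        thus "f' z = val Q" by (rule f'val[OF Q(1) _ nc(2)])
      qed
    qed
    ultimately show ?thesis by blast
  next
    case False
    have cE: "c \<in> crossings E \<inter> - disk"
      using c False out unfolding agree_on_def by blast
    hence over: "\<forall>\<^sub>F z in nhds c. z \<in> over E \<longleftrightarrow> z \<in> over E'"
      using out unfolding agree_on_def germ_eq_def by blast
    obtain a b where
      ab: "\<forall>\<^sub>F z in nhds c. z \<in> hat E \<and> z \<in> over E \<longrightarrow> f z = a"
      "\<forall>\<^sub>F z in nhds c. z \<in> hat E \<and> z \<notin> over E \<longrightarrow> f z = b"
      using f cE unfolding colouring_def by blast
    have "\<forall>\<^sub>F z in nhds c. z \<in> - disk"
      using False open_outside by (intro eventually_nhds_in_open) simp_all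
    hence near: "\<forall>\<^sub>F z in nhds c. f' z = f z \<and> (z \<in> hat E \<longleftrightarrow> z \<in> hat E')"
    proof eventually_elim
      case (elim z)
      hence "z \<notin> disk_interior" using disk_interior_subset by blast
      thus ?case using f'_out hat by blast
    qed
    have "\<forall>\<^sub>F z in nhds c. z \<in> hat E' \<and> z \<in> over E' \<longrightarrow> f' z = a"
      using ab(1) near over by eventually_elim blast
    moreover have "\<forall>\<^sub>F z in nhds c. z \<in> hat E' \<and> z \<notin> over E' \<longrightarrow> f' z = b"
      using ab(2) near over by eventually_elim blast
    ultimately show ?thesis by blast
  qed
  have "colouring E' f'" using supp cont cr unfolding colouring_def by blast
  thus ?thesis using f'_out by blast
qed

text \<open>
  Every class reaches the boundary of the disk and has the colour that is seen there.
\<close>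
lemma colouring_determined_outside:
  assumes L: "resolution L \<P>" "agree_on disk E L" "finite (crossings E)"
    and f: "colouring E f" "colouring E g" and eq: "\<And>z. z \<notin> disk_interior \<Longrightarrow> f z = g z"
  shows "f = g"
proof
  fix z
  note aL = agree_on_disk_resolution[OF L(2,1)]
  show "f z = g z"
  proof (cases "z \<in> disk_interior \<and> z \<in> hat E")
    case False
    thus ?thesis using eq f unfolding colouring_def by blast
  next
    case True
    hence "z \<in> curve L" using aL(1) disk_interior_subset unfolding hat_def by blast
    then obtain P where P: "P \<in> \<P>" "z \<in> \<Union>P" unfolding resolution_cover[OF L(1)] by blast
    obtain b where b: "b \<in> \<Union>P" "b \<notin> disk_interior" by (rule resolution_reaches_rim[OF L(1) P(1)])
    have "b \<in> disk" using b(1) P(1) resolution_subset[OF L(1)] resolution_disk[OF L(1)] by blast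
    hence "b \<notin> crossings E" using b(2) aL(2) resolution_crossings[OF L(1)] by blast
    moreover have "z \<notin> crossings E" using True unfolding hat_def by blast
    ultimately have zb: "z \<in> \<Union>P - crossings E" "b \<in> \<Union>P - crossings E" using P(2) b(1) by blast+
    have "f z = f b" using resolution_constant[OF L f(1) P(1)] zb by blast
    also have "\<dots> = g b" by (rule eq[OF b(2)])
    also have "\<dots> = g z" using resolution_constant[OF L f(2) P(1)] zb by blast
    finally show ?thesis .
  qed
qed

lemma card_colourings_local:
  assumes L: "resolution L \<P>" "agree_on disk E L" "finite (crossings E)"
    and R: "resolution R \<Q>" "agree_on disk E' R" "finite (crossings E')"
    and out: "agree_on (- disk) E E'"
    and traces: "(\<lambda>P. \<Union>P - disk_interior) ` \<P> = (\<lambda>Q. \<Union>Q - disk_interior) ` \<Q>"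
  shows "card {f. colouring E f} = card {f. colouring E' f}"
proof -
  (* Restriction to the complement of the open disk; it is injective on colourings of either diagram,
     and transfer in both directions shows that its images are the same. *)
  define \<rho> :: "(complex \<Rightarrow> bool) \<Rightarrow> complex \<Rightarrow> bool" where "\<rho> f z \<longleftrightarrow> z \<notin> disk_interior \<and> f z" for f z
  have rho: "\<rho> f = \<rho> g \<longleftrightarrow> (\<forall>z. z \<notin> disk_interior \<longrightarrow> f z = g z)" for f g
    by (auto simp: \<rho>_def fun_eq_iff)
  have img: "\<rho> ` {f. colouring E f} = \<rho> ` {f. colouring E' f}"
  proof (intro equalityI subsetI)
    fix x assume "x \<in> \<rho> ` {f. colouring E f}"
    then obtain f where f: "colouring E f" "x = \<rho> f" by blast
    obtain f' where "colouring E' f'" "\<rho> f' = \<rho> f"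
      using colouring_transfer[OF L R(1,2) out traces f(1)] rho by blast
    thus "x \<in> \<rho> ` {f. colouring E' f}" unfolding f(2) by (metis imageI mem_Collect_eq)
  next
    fix x assume "x \<in> \<rho> ` {f. colouring E' f}"
    then obtain f where f: "colouring E' f" "x = \<rho> f" by blast
    obtain f' where "colouring E f'" "\<rho> f' = \<rho> f"
      using colouring_transfer[OF R L(1,2) agree_on_sym[OF out] traces[symmetric] f(1)] rho by blast
    thus "x \<in> \<rho> ` {f. colouring E f}" unfolding f(2) by (metis imageI mem_Collect_eq)
  qed
  have inj: "inj_on \<rho> {f. colouring E f}"
  proof (rule inj_onI)
    fix f g assume fg: "f \<in> {f. colouring E f}" "g \<in> {f. colouring E f}" and "\<rho> f = \<rho> g"
    hence "\<And>z. z \<notin> disk_interior \<Longrightarrow> f z = g z" unfolding rho by simp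
    thus "f = g" using colouring_determined_outside[OF L] fg by simp
  qed
  have inj': "inj_on \<rho> {f. colouring E' f}"
  proof (rule inj_onI)
    fix f g assume fg: "f \<in> {f. colouring E' f}" "g \<in> {f. colouring E' f}" and "\<rho> f = \<rho> g"
    hence "\<And>z. z \<notin> disk_interior \<Longrightarrow> f z = g z" unfolding rho by simp
    thus "f = g" using colouring_determined_outside[OF R] fg by simp
  qed
  show ?thesis using card_image[OF inj] card_image[OF inj'] unfolding img by simp
qed

text \<open>
  \<open>X\<close> is the partition of the boundary points of the disk induced by the local picture.
\<close>
definition connects :: "diagram \<Rightarrow> complex set set \<Rightarrow> bool" where
  "connects L X \<longleftrightarrow> (\<exists>\<P>. resolution L \<P> \<and> (\<lambda>P. \<Union>P - disk_interior) ` \<P> = X)"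

theorem card_colourings_replaces:
  assumes "connects L X" "connects R X" "replaces L R D D'"
  shows "card {f. colouring D f} = card {f. colouring D' f}"
proof -
  obtain \<P> \<Q> where \<P>: "resolution L \<P>" "(\<lambda>P. \<Union>P - disk_interior) ` \<P> = X"
    and \<Q>: "resolution R \<Q>" "(\<lambda>Q. \<Union>Q - disk_interior) ` \<Q> = X"
    using assms(1,2) unfolding connects_def by blast
  obtain E E' where E: "marked_graph_diagram E" "marked_graph_diagram E'"
    and iso: "isotopic D E" "isotopic E' D'"
    and ag: "agree_on disk E L" "agree_on disk E' R" "agree_on (- disk) E E'"
    using assms(3) unfolding replaces_def by blast
  have fin: "finite (crossings E)" "finite (crossings E')"
    using E by (simp_all add: marked_graph_diagram_def)
  have "card {f. colouring D f} = card {f. colouring E f}"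
    by (rule card_colourings_isotopic[OF iso(1)])
  also have "\<dots> = card {f. colouring E' f}"
    by (rule card_colourings_local[OF \<P>(1) ag(1) fin(1) \<Q>(1) ag(2) fin(2) ag(3)])
       (simp add: \<P>(2) \<Q>(2))
  also have "\<dots> = card {f. colouring D' f}"
    by (rule card_colourings_isotopic[OF iso(2)])
  finally show ?thesis .
qed

section \<open>Polygonal pictures\<close>

text \<open>
  A description of segments without quantifiers: the bounding box together with collinearity. With
  numerals as coordinates all inequalities and equations become linear, so that statements about
  polygonal pictures are decided by linear arithmetic.
\<close>
lemma in_segment_iff:
  "z \<in> closed_segment (Complex a b) (Complex c d) \<longleftrightarrow>
     min a c \<le> Re z \<and> Re z \<le> max a c \<and> min b d \<le> Im z \<and> Im z \<le> max b d \<and>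
     (Re z - a) * (d - b) = (Im z - b) * (c - a)"
proof
  assume "z \<in> closed_segment (Complex a b) (Complex c d)"
  then obtain u where u: "0 \<le> u" "u \<le> 1" "z = (1 - u) *\<^sub>R Complex a b + u *\<^sub>R Complex c d"
    by (auto simp: in_segment)
  hence z: "Re z = (1 - u) * a + u * c" "Im z = (1 - u) * b + u * d" by simp_all
  have conv: "min p q \<le> (1 - u) * p + u * q \<and> (1 - u) * p + u * q \<le> max p q" for p q :: real
  proof -
    have "(1 - u) * min p q + u * min p q \<le> (1 - u) * p + u * q"
      using u(1,2) by (intro add_mono mult_left_mono) simp_all
    moreover have "(1 - u) * p + u * q \<le> (1 - u) * max p q + u * max p q"
      using u(1,2) by (intro add_mono mult_left_mono) simp_all
    ultimately show ?thesis by (simp add: algebra_simps)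
  qed
  have "(Re z - a) * (d - b) = (Im z - b) * (c - a)"
    unfolding z by (simp add: algebra_simps)
  thus "min a c \<le> Re z \<and> Re z \<le> max a c \<and> min b d \<le> Im z \<and> Im z \<le> max b d \<and>
     (Re z - a) * (d - b) = (Im z - b) * (c - a)"
    using conv z by simp
next
  assume *: "min a c \<le> Re z \<and> Re z \<le> max a c \<and> min b d \<le> Im z \<and> Im z \<le> max b d \<and>
     (Re z - a) * (d - b) = (Im z - b) * (c - a)"
  have param: "\<exists>u. 0 \<le> u \<and> u \<le> 1 \<and> u * (q - p) = x - p"
    if "min p q \<le> x" "x \<le> max p q" "p \<noteq> q" for p q x :: real
    using that by (intro exI[of _ "(x - p) / (q - p)"])
      (auto simp: divide_le_eq zero_le_divide_iff min_def max_def split: if_splits)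
  have "\<exists>u. 0 \<le> u \<and> u \<le> 1 \<and> Re z = (1 - u) * a + u * c \<and> Im z = (1 - u) * b + u * d"
  proof (cases "a = c")
    case False
    then obtain u where u: "0 \<le> u" "u \<le> 1" "u * (c - a) = Re z - a" using param * by blast
    have "(c - a) * (u * (d - b)) = (u * (c - a)) * (d - b)" by simp
    also have "\<dots> = (Im z - b) * (c - a)" unfolding u(3) using * by blast
    finally have "(c - a) * (u * (d - b)) = (c - a) * (Im z - b)" by simp
    hence "u * (d - b) = Im z - b" using False by simp
    thus ?thesis using u by (intro exI[of _ u]) (simp add: algebra_simps)
  next
    case True
    hence re: "Re z = a" using * by simp
    show ?thesis
    proof (cases "b = d")
      case True
      hence "Im z = b" using * by simp
      thus ?thesis using re \<open>a = c\<close> True by (intro exI[of _ 0]) simp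
    next
      case False
      then obtain u where "0 \<le> u" "u \<le> 1" "u * (d - b) = Im z - b" using param * by blast
      thus ?thesis using re \<open>a = c\<close> by (intro exI[of _ u]) (simp add: algebra_simps)
    qed
  qed
  then obtain u where u: "0 \<le> u" "u \<le> 1" "Re z = (1 - u) * a + u * c" "Im z = (1 - u) * b + u * d"
    by blast
  have "z = (1 - u) *\<^sub>R Complex a b + u *\<^sub>R Complex c d"
    by (rule complex_eqI) (simp_all add: u)
  thus "z \<in> closed_segment (Complex a b) (Complex c d)"
    using u(1,2) by (auto simp: in_segment)
qed

lemma closed_polyline: "closed (polyline ps)"
  by (induction ps rule: polyline.induct) (auto intro: closed_Un)

lemma head_in_polyline: "Complex c d \<in> polyline ((c, d) # p # ps)"
  by (cases p) simp

lemma connected_polyline: "connected (polyline ps)"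
proof (induction ps rule: polyline.induct)
  case (1 a b c d ps)
  show ?case
  proof (cases ps)
    case (Cons p qs)
    hence "Complex c d \<in> polyline ((c, d) # ps)" using head_in_polyline by simp
    moreover have "Complex c d \<in> closed_segment (Complex a b) (Complex c d)" by simp
    ultimately have "closed_segment (Complex a b) (Complex c d) \<inter> polyline ((c, d) # ps) \<noteq> {}" by blast
    thus ?thesis unfolding polyline.simps by (rule connected_Un[OF connected_segment 1])
  qed (simp)
qed simp_all

lemma polyline_subset_convex:
  assumes "convex K" "\<forall>(a, b) \<in> set ps. Complex a b \<in> K"
  shows "polyline ps \<subseteq> K"
  using assms(2)
proof (induction ps rule: polyline.induct)
  case (1 a b c d ps)
  hence "closed_segment (Complex a b) (Complex c d) \<subseteq> K"
    by (intro closed_segment_subset assms(1)) auto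
  thus ?case using 1 by auto
qed simp_all

text \<open>
  A square instead of a round neighbourhood, again to keep the conditions linear. It is
  small enough for all pictures: the segments that mark the over-strands extend beyond it, and it
  contains no second crossing.
\<close>
definition near :: "complex \<Rightarrow> complex \<Rightarrow> bool" where
  "near c z \<longleftrightarrow> \<bar>Re z - Re c\<bar> < 1/4 \<and> \<bar>Im z - Im c\<bar> < 1/4"

lemma eventually_near: "\<forall>\<^sub>F z in nhds c. near c z"
proof -
  have "dist z c < 1/4 \<Longrightarrow> near c z" for z
    using abs_Re_le_cmod[of "z - c"] abs_Im_le_cmod[of "z - c"] by (simp add: near_def dist_norm)
  thus ?thesis unfolding eventually_nhds_metric by (intro exI[of _ "1/4"]) simp
qed

text \<open>
  The strands other than \<open>S\<close> and \<open>T\<close> are closed and avoid \<open>c\<close>, so near \<open>c\<close> the curve is the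
  union of \<open>S\<close> and \<open>T\<close>.
\<close>
lemma strands_atI:
  assumes fin: "finite SS" and cl: "\<And>R. R \<in> SS \<Longrightarrow> closed R" and cov: "curve L = \<Union>SS"
    and ST: "S \<in> SS" "T \<in> SS" and only: "\<And>R. R \<in> SS \<Longrightarrow> c \<in> R \<Longrightarrow> R = S \<or> R = T"
    and over: "\<And>z. near c z \<Longrightarrow> z \<in> S \<Longrightarrow> z \<in> over L"
    and under: "\<And>z. near c z \<Longrightarrow> z \<in> T \<Longrightarrow> z \<in> over L \<Longrightarrow> z = c"
  shows "strands_at L c S T"
proof -
  have "closed (\<Union>(SS - {S, T}))"
    using fin cl by (intro closed_Union) auto
  hence op: "open (- \<Union>(SS - {S, T}))" by (rule open_Compl)
  have "c \<in> - \<Union>(SS - {S, T})" using only by blast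
  hence "\<forall>\<^sub>F z in nhds c. z \<in> - \<Union>(SS - {S, T})" by (rule eventually_nhds_in_open[OF op])
  thus ?thesis unfolding strands_at_def using eventually_near[of c]
  proof eventually_elim
    case (elim z)
    have "z \<in> curve L \<longleftrightarrow> z \<in> S \<or> z \<in> T" using elim(1) ST unfolding cov by blast
    thus ?case using over[OF elim(2)] under[OF elim(2)] by blast
  qed
qed

text \<open>
  The strand \<open>s\<close> passes over the strand \<open>t\<close>. The last two conditions say this in the form that
  \<open>strands_atI\<close> uses.
\<close>
definition crosses :: "diagram \<Rightarrow> (real \<times> real) list list \<Rightarrow> complex \<Rightarrow> (real \<times> real) list \<Rightarrow> (real \<times> real) list \<Rightarrow> bool" where
  "crosses L rs c s t \<longleftrightarrow> s \<in> set rs \<and> t \<in> set rs \<and>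
     (\<forall>r \<in> set rs. c \<in> polyline r \<longrightarrow> r = s \<or> r = t) \<and>
     (\<forall>z. near c z \<longrightarrow> z \<in> polyline s \<longrightarrow> z \<in> over L) \<and>
     (\<forall>z. near c z \<longrightarrow> z \<in> polyline t \<longrightarrow> z \<in> over L \<longrightarrow> z = c)"

definition separate :: "diagram \<Rightarrow> (real \<times> real) list list \<Rightarrow> (real \<times> real) list list \<Rightarrow> bool" where
  "separate L ps qs \<longleftrightarrow> (\<forall>p \<in> set ps. \<forall>q \<in> set qs. polyline p \<inter> polyline q \<subseteq> crossings L)"

definition meet :: "diagram \<Rightarrow> (real \<times> real) list \<Rightarrow> (real \<times> real) list \<Rightarrow> bool" where
  "meet L p q \<longleftrightarrow> (\<exists>w \<in> polyline p. w \<in> polyline q \<and> w \<notin> crossings L)"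

text \<open>
  \<open>Ps\<close> lists the classes; each class is a list of polygonal strands headed by its hub. As
  \<open>separate\<close> is symmetric in the two classes, each pair needs to be compared only once.
\<close>
lemma connectsI:
  fixes Ps :: "(real \<times> real) list list list"
  assumes cover: "curve L = (\<Union>p \<in> set (concat Ps). polyline p)"
    and corners: "\<forall>p \<in> set (concat Ps). \<forall>(a, b) \<in> set p. Complex a b \<in> disk"
    and int: "crossings L \<subseteq> disk_interior"
    and apart: "sorted_wrt (separate L) Ps"
    and hub: "\<forall>ps \<in> set Ps. ps \<noteq> [] \<and> list_all (meet L (hd ps)) (tl ps)"
    and cross: "\<forall>c \<in> crossings L. \<exists>s t. crosses L (concat Ps) c s t"
    and rim: "(\<lambda>ps. \<Union>p \<in> set ps. polyline p - disk_interior) ` set Ps = X" "{} \<notin> X"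
  shows "connects L X"
proof -
  define \<P> where "\<P> = (\<lambda>ps. polyline ` set ps) ` set Ps"
  have union_eq: "\<Union>\<P> = polyline ` set (concat Ps)"
    by (auto simp: \<P>_def)
  have X: "(\<lambda>P. \<Union>P - disk_interior) ` \<P> = X"
    unfolding \<P>_def rim(1)[symmetric] image_image by (rule image_cong) auto
  have "resolution L \<P>"
    unfolding resolution_def
  proof (intro conjI)
    show "finite \<P>" by (simp add: \<P>_def)
    show "\<forall>P\<in>\<P>. finite P" by (simp add: \<P>_def)
    show "\<forall>P\<in>\<P>. \<forall>S\<in>P. connected S \<and> closed S"
      by (simp add: \<P>_def connected_polyline closed_polyline)
    show "\<Union>(\<Union>\<P>) = curve L" unfolding union_eq cover by simp
    have "polyline p \<subseteq> disk" if "p \<in> set (concat Ps)" for p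
    proof (rule polyline_subset_convex)
      show "convex disk" by (simp add: disk_def)
      show "\<forall>(a, b) \<in> set p. Complex a b \<in> disk" using corners that by blast
    qed
    thus "curve L \<subseteq> disk" unfolding cover by blast
    show "crossings L \<subseteq> disk_interior" by (rule int)
    have disj: "(\<Union>p\<in>set ps. polyline p) \<inter> (\<Union>q\<in>set qs. polyline q) \<subseteq> crossings L"
      if ps: "ps \<in> set Ps" and qs: "qs \<in> set Ps" and "ps \<noteq> qs" for ps qs
    proof -
      obtain i j where ij: "i < length Ps" "j < length Ps" "ps = Ps ! i" "qs = Ps ! j"
        using ps qs by (metis in_set_conv_nth)
      hence "i < j \<or> j < i" using \<open>ps \<noteq> qs\<close> by (metis linorder_neqE_nat)
      hence "(\<forall>p \<in> set ps. \<forall>q \<in> set qs. polyline p \<inter> polyline q \<subseteq> crossings L) \<or>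
             (\<forall>p \<in> set qs. \<forall>q \<in> set ps. polyline p \<inter> polyline q \<subseteq> crossings L)"
        using apart[unfolded sorted_wrt_iff_nth_less separate_def] ij by blast
      thus ?thesis by blast
    qed
    show "\<forall>P\<in>\<P>. \<forall>Q\<in>\<P>. P \<noteq> Q \<longrightarrow> \<Union>P \<inter> \<Union>Q \<subseteq> crossings L"
    proof (intro ballI impI)
      fix P Q assume "P \<in> \<P>" "Q \<in> \<P>" "P \<noteq> Q"
      then obtain ps qs where "ps \<in> set Ps" "qs \<in> set Ps" "P = polyline ` set ps" "Q = polyline ` set qs"
        unfolding \<P>_def by blast
      thus "\<Union>P \<inter> \<Union>Q \<subseteq> crossings L" using disj[of ps qs] \<open>P \<noteq> Q\<close> by blast
    qed
    show "\<forall>P\<in>\<P>. \<not> \<Union>P \<subseteq> disk_interior"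
    proof (intro ballI notI)
      fix P assume "P \<in> \<P>" "\<Union>P \<subseteq> disk_interior"
      hence "{} \<in> (\<lambda>P. \<Union>P - disk_interior) ` \<P>" by (metis Diff_eq_empty_iff imageI)
      thus False using X rim(2) by simp
    qed
    show "\<forall>P\<in>\<P>. \<exists>S\<in>P. \<forall>T\<in>P. T \<noteq> S \<longrightarrow> \<not> S \<inter> T \<subseteq> crossings L"
    proof
      fix P assume "P \<in> \<P>"
      then obtain ps where ps: "ps \<in> set Ps" "P = polyline ` set ps" unfolding \<P>_def by blast
      hence ne: "ps \<noteq> []" and meet: "\<forall>p \<in> set (tl ps). meet L (hd ps) p"
        using hub unfolding list_all_iff by blast+
      have set_ps: "set ps = insert (hd ps) (set (tl ps))" using ne by (metis list.collapse list.simps(15))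
      show "\<exists>S\<in>P. \<forall>T\<in>P. T \<noteq> S \<longrightarrow> \<not> S \<inter> T \<subseteq> crossings L"
      proof (intro bexI ballI impI)
        show "polyline (hd ps) \<in> P" unfolding ps(2) set_ps by simp
        fix T assume "T \<in> P" "T \<noteq> polyline (hd ps)"
        then obtain p where "p \<in> set (tl ps)" "T = polyline p" unfolding ps(2) set_ps by blast
        thus "\<not> polyline (hd ps) \<inter> T \<subseteq> crossings L" using meet unfolding meet_def by blast
      qed
    qed
    show "\<forall>c\<in>crossings L. \<exists>S\<in>\<Union> \<P>. \<exists>T\<in>\<Union> \<P>. strands_at L c S T \<and> (\<forall>R\<in>\<Union> \<P>. c \<in> R \<longrightarrow> R = S \<or> R = T)"
    proof
      fix c assume "c \<in> crossings L"
      then obtain s t where cr: "crosses L (concat Ps) c s t" using cross by blast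
      have S: "polyline s \<in> \<Union>\<P>" "polyline t \<in> \<Union>\<P>"
        using cr unfolding union_eq crosses_def by blast+
      have only: "R = polyline s \<or> R = polyline t" if "R \<in> \<Union>\<P>" "c \<in> R" for R
        using cr that unfolding union_eq crosses_def by blast
      have "strands_at L c (polyline s) (polyline t)"
      proof (rule strands_atI[of "\<Union>\<P>"])
        show "finite (\<Union>\<P>)" unfolding union_eq by simp
        show "closed R" if "R \<in> \<Union>\<P>" for R using that closed_polyline unfolding union_eq by blast
        show "curve L = \<Union>(\<Union>\<P>)" unfolding union_eq cover ..
      qed (use S only cr in \<open>simp_all add: crosses_def\<close>)
      thus "\<exists>S\<in>\<Union>\<P>. \<exists>T\<in>\<Union>\<P>. strands_at L c S T \<and> (\<forall>R\<in>\<Union>\<P>. c \<in> R \<longrightarrow> R = S \<or> R = T)"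
        using S only by blast
    qed
  qed
  thus ?thesis using X unfolding connects_def by blast
qed

section \<open>The pictures of the moves\<close>

lemma polyline_rims:
  "polyline [(-4, 2), (2, -1)] - disk_interior = {Complex (-4) 2}"
  "polyline [(2, -1), (2, 1)] - disk_interior = {}"
  "polyline [(2, 1), (-4, -2)] - disk_interior = {Complex (-4) (-2)}"
  "polyline [(-4, 2), (2, 0), (-4, -2)] - disk_interior = {Complex (-4) (-2), Complex (-4) 2}"
  "polyline [(-2, 4), (2, 0), (-2, -4)] - disk_interior = {Complex (-2) (-4), Complex (-2) 4}"
  "polyline [(2, 4), (-2, 0), (2, -4)] - disk_interior = {Complex 2 (-4), Complex 2 4}"
  "polyline [(-2, 4), (-2, -4)] - disk_interior = {Complex (-2) (-4), Complex (-2) 4}"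
  "polyline [(2, 4), (2, -4)] - disk_interior = {Complex 2 (-4), Complex 2 4}"
  "polyline [(-2, 4), (2, -4)] - disk_interior = {Complex (-2) 4, Complex 2 (-4)}"
  "polyline [(-2, -4), (2, 4)] - disk_interior = {Complex (-2) (-4), Complex 2 4}"
  "polyline [(-4, 0), (-3, -2), (3, -2), (4, 0)] - disk_interior = {Complex (-4) 0, Complex 4 0}"
  "polyline [(-4, 0), (-3, 2), (3, 2), (4, 0)] - disk_interior = {Complex (-4) 0, Complex 4 0}"
  "polyline [(-4, 2), (0, -2), (4, 2)] - disk_interior = {Complex (-4) 2, Complex 4 2}"
  "polyline [(-4, -2), (0, 2), (4, -2)] - disk_interior = {Complex (-4) (-2), Complex 4 (-2)}"
  "polyline [(-2, -4), (-2, -2), (2, 2), (2, 4)] - disk_interior = {Complex (-2) (-4), Complex 2 4}"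
  "polyline [(-2, 4), (-2, 0), (0, -2), (0, -4)] - disk_interior = {Complex (-2) 4, Complex 0 (-4)}"
  "polyline [(0, 4), (0, 2), (2, 0), (2, -4)] - disk_interior = {Complex 0 4, Complex 2 (-4)}"
  "polyline [(-2, 4), (-2, 2), (2, -2), (2, -4)] - disk_interior = {Complex (-2) 4, Complex 2 (-4)}"
  "polyline [(-2, -4), (-2, 0), (0, 2), (0, 4)] - disk_interior = {Complex (-2) (-4), Complex 0 4}"
  "polyline [(0, -4), (0, -2), (2, 0), (2, 4)] - disk_interior = {Complex 0 (-4), Complex 2 4}"
  "polyline [(-3, 4), (-3, 3), (-1, 1), (-1, 0), (3, -4)] - disk_interior = {Complex (-3) 4, Complex 3 (-4)}"
  "polyline [(-1, 4), (-1, 3), (-3, 1), (-3, 0), (1, -4)] - disk_interior = {Complex (-1) 4, Complex 1 (-4)}"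
  "polyline [(3, 4), (3, 3), (1, 1), (1, 0), (-3, -4)] - disk_interior = {Complex (-3) (-4), Complex 3 4}"
  "polyline [(1, 4), (1, 3), (3, 1), (3, 0), (-1, -4)] - disk_interior = {Complex (-1) (-4), Complex 1 4}"
  by (auto simp: in_segment_iff disk_interior_def in_box_complex_iff complex_eq_iff)

text \<open>
  The kink is cut into its two straight strands and the arc joining them, because one connected
  strand may pass only once through the crossing.
\<close>
lemma connects_Omega1_left:
  "connects (left_side Omega1)
     {{Complex (-4) (-2), Complex (-4) 2}}"
proof (rule connectsI)
  let ?L = "left_side Omega1"
  let ?Ps =
    "[[[(2, -1), (2, 1)],
        [(-4, 2), (2, -1)],
        [(2, 1), (-4, -2)]]]"
  show "curve ?L = (\<Union>p \<in> set (concat ?Ps). polyline p)"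
    "\<forall>p \<in> set (concat ?Ps). \<forall>(a, b) \<in> set p. Complex a b \<in> disk"
    "crossings ?L \<subseteq> disk_interior"
    by (auto simp: kink_def
        disk_def disk_interior_def in_cbox_complex_iff in_box_complex_iff)
  show "sorted_wrt (separate ?L) ?Ps" by simp
  have m1: "meet ?L [(2, -1), (2, 1)] [(-4, 2), (2, -1)]"
    unfolding meet_def by (rule bexI[of _ "Complex 2 (-1)"]) (simp_all add: in_segment_iff complex_eq_iff)
  have m2: "meet ?L [(2, -1), (2, 1)] [(2, 1), (-4, -2)]"
    unfolding meet_def by (rule bexI[of _ "Complex 2 1"]) (simp_all add: in_segment_iff complex_eq_iff)
  show "\<forall>ps \<in> set ?Ps. ps \<noteq> [] \<and> list_all (meet ?L (hd ps)) (tl ps)"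
    using m1 m2 by simp
  have c1: "crosses ?L (concat ?Ps) (Complex 0 0)
      [(2, 1), (-4, -2)]
      [(-4, 2), (2, -1)]"
    by (auto simp: crosses_def near_def in_segment_iff complex_eq_iff)
  show "\<forall>c \<in> crossings ?L. \<exists>s t. crosses ?L (concat ?Ps) c s t"
    using c1 by (auto simp: zero_complex.code)
  show "(\<lambda>ps. \<Union>p \<in> set ps. polyline p - disk_interior) ` set ?Ps =
      {{Complex (-4) (-2), Complex (-4) 2}}"
    by (simp add: polyline_rims Un_Diff insert_commute del: polyline.simps)
  show "{} \<notin> {{Complex (-4) (-2), Complex (-4) 2}}"
    by simp
qed

lemma connects_simple_arc:
  "connects simple_arc
     {{Complex (-4) (-2), Complex (-4) 2}}"
proof (rule connectsI)
  let ?L = "simple_arc"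
  let ?Ps =
    "[[[(-4, 2), (2, 0), (-4, -2)]]]"
  show "curve ?L = (\<Union>p \<in> set (concat ?Ps). polyline p)"
    "\<forall>p \<in> set (concat ?Ps). \<forall>(a, b) \<in> set p. Complex a b \<in> disk"
    "crossings ?L \<subseteq> disk_interior"
    by (auto simp: simple_arc_def
        disk_def disk_interior_def in_cbox_complex_iff in_box_complex_iff)
  show "sorted_wrt (separate ?L) ?Ps" by simp
  show "\<forall>ps \<in> set ?Ps. ps \<noteq> [] \<and> list_all (meet ?L (hd ps)) (tl ps)"
    by simp
  show "\<forall>c \<in> crossings ?L. \<exists>s t. crosses ?L (concat ?Ps) c s t"
    by (simp add: simple_arc_def)
  show "(\<lambda>ps. \<Union>p \<in> set ps. polyline p - disk_interior) ` set ?Ps =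
      {{Complex (-4) (-2), Complex (-4) 2}}"
    by (simp add: polyline_rims Un_Diff insert_commute del: polyline.simps)
  show "{} \<notin> {{Complex (-4) (-2), Complex (-4) 2}}"
    by simp
qed

text \<open>
  Both boundary points on the left belong to the strand that starts on the left: it returns
  after the second crossing.
\<close>
lemma connects_Omega2_left:
  "connects (left_side Omega2)
     {{Complex (-2) (-4), Complex (-2) 4}, {Complex 2 (-4), Complex 2 4}}"
proof (rule connectsI)
  let ?L = "left_side Omega2"
  let ?Ps =
    "[[[(-2, 4), (2, 0), (-2, -4)]],
       [[(2, 4), (-2, 0), (2, -4)]]]"
  show "curve ?L = (\<Union>p \<in> set (concat ?Ps). polyline p)"
    "\<forall>p \<in> set (concat ?Ps). \<forall>(a, b) \<in> set p. Complex a b \<in> disk"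
    "crossings ?L \<subseteq> disk_interior"
    by (auto simp:
        disk_def disk_interior_def in_cbox_complex_iff in_box_complex_iff)
  show "sorted_wrt (separate ?L) ?Ps"
    by (auto simp: separate_def in_segment_iff complex_eq_iff)
  show "\<forall>ps \<in> set ?Ps. ps \<noteq> [] \<and> list_all (meet ?L (hd ps)) (tl ps)"
    by simp
  have c1: "crosses ?L (concat ?Ps) (Complex 0 2)
      [(-2, 4), (2, 0), (-2, -4)]
      [(2, 4), (-2, 0), (2, -4)]"
    by (auto simp: crosses_def near_def in_segment_iff complex_eq_iff)
  have c2: "crosses ?L (concat ?Ps) (Complex 0 (-2))
      [(-2, 4), (2, 0), (-2, -4)]
      [(2, 4), (-2, 0), (2, -4)]"
    by (auto simp: crosses_def near_def in_segment_iff complex_eq_iff)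
  show "\<forall>c \<in> crossings ?L. \<exists>s t. crosses ?L (concat ?Ps) c s t"
    using c1 c2 by (auto simp: zero_complex.code)
  show "(\<lambda>ps. \<Union>p \<in> set ps. polyline p - disk_interior) ` set ?Ps =
      {{Complex (-2) (-4), Complex (-2) 4}, {Complex 2 (-4), Complex 2 4}}"
    by (simp add: polyline_rims Un_Diff insert_commute del: polyline.simps)
  show "{} \<notin> {{Complex (-2) (-4), Complex (-2) 4}, {Complex 2 (-4), Complex 2 4}}"
    by simp
qed

lemma connects_Omega2_right:
  "connects (right_side Omega2)
     {{Complex (-2) (-4), Complex (-2) 4}, {Complex 2 (-4), Complex 2 4}}"
proof (rule connectsI)
  let ?L = "right_side Omega2"
  let ?Ps =
    "[[[(-2, 4), (-2, -4)]],
       [[(2, 4), (2, -4)]]]"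
  show "curve ?L = (\<Union>p \<in> set (concat ?Ps). polyline p)"
    "\<forall>p \<in> set (concat ?Ps). \<forall>(a, b) \<in> set p. Complex a b \<in> disk"
    "crossings ?L \<subseteq> disk_interior"
    by (auto simp:
        disk_def disk_interior_def in_cbox_complex_iff in_box_complex_iff)
  show "sorted_wrt (separate ?L) ?Ps"
    by (auto simp: separate_def in_segment_iff complex_eq_iff)
  show "\<forall>ps \<in> set ?Ps. ps \<noteq> [] \<and> list_all (meet ?L (hd ps)) (tl ps)"
    by simp
  show "\<forall>c \<in> crossings ?L. \<exists>s t. crosses ?L (concat ?Ps) c s t"
    by simp
  show "(\<lambda>ps. \<Union>p \<in> set ps. polyline p - disk_interior) ` set ?Ps =
      {{Complex (-2) (-4), Complex (-2) 4}, {Complex 2 (-4), Complex 2 4}}"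
    by (simp add: polyline_rims Un_Diff insert_commute del: polyline.simps)
  show "{} \<notin> {{Complex (-2) (-4), Complex (-2) 4}, {Complex 2 (-4), Complex 2 4}}"
    by simp
qed

text \<open>
  Each of the three strands keeps its end points when it slides, and colours ignore the crossings.
\<close>
lemma connects_Omega3_left:
  "connects (left_side Omega3)
     {{Complex (-2) 4, Complex 2 (-4)}, {Complex (-2) (-4), Complex 2 4}, {Complex (-4) 0, Complex 4 0}}"
proof (rule connectsI)
  let ?L = "left_side Omega3"
  let ?Ps =
    "[[[(-2, 4), (2, -4)]],
       [[(-2, -4), (2, 4)]],
       [[(-4, 0), (-3, -2), (3, -2), (4, 0)]]]"
  show "curve ?L = (\<Union>p \<in> set (concat ?Ps). polyline p)"
    "\<forall>p \<in> set (concat ?Ps). \<forall>(a, b) \<in> set p. Complex a b \<in> disk"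
    "crossings ?L \<subseteq> disk_interior"
    by (auto simp: strand_NW_SE_def strand_SW_NE_def H_below_def
        disk_def disk_interior_def in_cbox_complex_iff in_box_complex_iff)
  show "sorted_wrt (separate ?L) ?Ps"
    by (auto simp: separate_def in_segment_iff complex_eq_iff)
  show "\<forall>ps \<in> set ?Ps. ps \<noteq> [] \<and> list_all (meet ?L (hd ps)) (tl ps)"
    by simp
  have c1: "crosses ?L (concat ?Ps) (Complex 0 0)
      [(-2, 4), (2, -4)]
      [(-2, -4), (2, 4)]"
    by (auto simp: crosses_def near_def in_segment_iff complex_eq_iff
        strand_NW_SE_def strand_SW_NE_def H_below_def)
  have c2: "crosses ?L (concat ?Ps) (Complex (-1) (-2))
      [(-4, 0), (-3, -2), (3, -2), (4, 0)]
      [(-2, -4), (2, 4)]"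
    by (auto simp: crosses_def near_def in_segment_iff complex_eq_iff
        strand_NW_SE_def strand_SW_NE_def H_below_def)
  have c3: "crosses ?L (concat ?Ps) (Complex 1 (-2))
      [(-4, 0), (-3, -2), (3, -2), (4, 0)]
      [(-2, 4), (2, -4)]"
    by (auto simp: crosses_def near_def in_segment_iff complex_eq_iff
        strand_NW_SE_def strand_SW_NE_def H_below_def)
  show "\<forall>c \<in> crossings ?L. \<exists>s t. crosses ?L (concat ?Ps) c s t"
    using c1 c2 c3 by (auto simp: zero_complex.code)
  show "(\<lambda>ps. \<Union>p \<in> set ps. polyline p - disk_interior) ` set ?Ps =
      {{Complex (-2) 4, Complex 2 (-4)}, {Complex (-2) (-4), Complex 2 4}, {Complex (-4) 0, Complex 4 0}}"
    by (simp add: polyline_rims Un_Diff insert_commute del: polyline.simps)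
  show "{} \<notin> {{Complex (-2) 4, Complex 2 (-4)}, {Complex (-2) (-4), Complex 2 4}, {Complex (-4) 0, Complex 4 0}}"
    by simp
qed

lemma connects_Omega3_right:
  "connects (right_side Omega3)
     {{Complex (-2) 4, Complex 2 (-4)}, {Complex (-2) (-4), Complex 2 4}, {Complex (-4) 0, Complex 4 0}}"
proof (rule connectsI)
  let ?L = "right_side Omega3"
  let ?Ps =
    "[[[(-2, 4), (2, -4)]],
       [[(-2, -4), (2, 4)]],
       [[(-4, 0), (-3, 2), (3, 2), (4, 0)]]]"
  show "curve ?L = (\<Union>p \<in> set (concat ?Ps). polyline p)"
    "\<forall>p \<in> set (concat ?Ps). \<forall>(a, b) \<in> set p. Complex a b \<in> disk"
    "crossings ?L \<subseteq> disk_interior"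
    by (auto simp: strand_NW_SE_def strand_SW_NE_def H_above_def
        disk_def disk_interior_def in_cbox_complex_iff in_box_complex_iff)
  show "sorted_wrt (separate ?L) ?Ps"
    by (auto simp: separate_def in_segment_iff complex_eq_iff)
  show "\<forall>ps \<in> set ?Ps. ps \<noteq> [] \<and> list_all (meet ?L (hd ps)) (tl ps)"
    by simp
  have c1: "crosses ?L (concat ?Ps) (Complex 0 0)
      [(-2, 4), (2, -4)]
      [(-2, -4), (2, 4)]"
    by (auto simp: crosses_def near_def in_segment_iff complex_eq_iff
        strand_NW_SE_def strand_SW_NE_def H_above_def)
  have c2: "crosses ?L (concat ?Ps) (Complex (-1) 2)
      [(-4, 0), (-3, 2), (3, 2), (4, 0)]
      [(-2, 4), (2, -4)]"
    by (auto simp: crosses_def near_def in_segment_iff complex_eq_iff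
        strand_NW_SE_def strand_SW_NE_def H_above_def)
  have c3: "crosses ?L (concat ?Ps) (Complex 1 2)
      [(-4, 0), (-3, 2), (3, 2), (4, 0)]
      [(-2, -4), (2, 4)]"
    by (auto simp: crosses_def near_def in_segment_iff complex_eq_iff
        strand_NW_SE_def strand_SW_NE_def H_above_def)
  show "\<forall>c \<in> crossings ?L. \<exists>s t. crosses ?L (concat ?Ps) c s t"
    using c1 c2 c3 by (auto simp: zero_complex.code)
  show "(\<lambda>ps. \<Union>p \<in> set ps. polyline p - disk_interior) ` set ?Ps =
      {{Complex (-2) 4, Complex 2 (-4)}, {Complex (-2) (-4), Complex 2 4}, {Complex (-4) 0, Complex 4 0}}"
    by (simp add: polyline_rims Un_Diff insert_commute del: polyline.simps)
  show "{} \<notin> {{Complex (-2) 4, Complex 2 (-4)}, {Complex (-2) (-4), Complex 2 4}, {Complex (-4) 0, Complex 4 0}}"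
    by simp
qed

text \<open>
  The strand sliding over the vertex ends where it did; the other four boundary points are
  tied together by the vertex.
\<close>
lemma connects_Omega4_left:
  "connects (left_side Omega4)
     {{Complex (-2) (-4), Complex (-2) 4, Complex 2 (-4), Complex 2 4}, {Complex (-4) 0, Complex 4 0}}"
proof (rule connectsI)
  let ?L = "left_side Omega4"
  let ?Ps =
    "[[[(-2, 4), (2, -4)],
        [(-2, -4), (2, 4)]],
       [[(-4, 0), (-3, -2), (3, -2), (4, 0)]]]"
  show "curve ?L = (\<Union>p \<in> set (concat ?Ps). polyline p)"
    "\<forall>p \<in> set (concat ?Ps). \<forall>(a, b) \<in> set p. Complex a b \<in> disk"
    "crossings ?L \<subseteq> disk_interior"
    by (auto simp: strand_NW_SE_def strand_SW_NE_def H_below_def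
        disk_def disk_interior_def in_cbox_complex_iff in_box_complex_iff)
  show "sorted_wrt (separate ?L) ?Ps"
    by (auto simp: separate_def in_segment_iff complex_eq_iff)
  have m1: "meet ?L [(-2, 4), (2, -4)] [(-2, -4), (2, 4)]"
    unfolding meet_def by (rule bexI[of _ "Complex 0 0"]) (simp_all add: in_segment_iff complex_eq_iff)
  show "\<forall>ps \<in> set ?Ps. ps \<noteq> [] \<and> list_all (meet ?L (hd ps)) (tl ps)"
    using m1 by simp
  have c1: "crosses ?L (concat ?Ps) (Complex (-1) (-2))
      [(-4, 0), (-3, -2), (3, -2), (4, 0)]
      [(-2, -4), (2, 4)]"
    by (auto simp: crosses_def near_def in_segment_iff complex_eq_iff
        strand_NW_SE_def strand_SW_NE_def H_below_def)
  have c2: "crosses ?L (concat ?Ps) (Complex 1 (-2))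
      [(-4, 0), (-3, -2), (3, -2), (4, 0)]
      [(-2, 4), (2, -4)]"
    by (auto simp: crosses_def near_def in_segment_iff complex_eq_iff
        strand_NW_SE_def strand_SW_NE_def H_below_def)
  show "\<forall>c \<in> crossings ?L. \<exists>s t. crosses ?L (concat ?Ps) c s t"
    using c1 c2 by (auto simp: zero_complex.code)
  show "(\<lambda>ps. \<Union>p \<in> set ps. polyline p - disk_interior) ` set ?Ps =
      {{Complex (-2) (-4), Complex (-2) 4, Complex 2 (-4), Complex 2 4}, {Complex (-4) 0, Complex 4 0}}"
    by (simp add: polyline_rims Un_Diff insert_commute del: polyline.simps)
  show "{} \<notin> {{Complex (-2) (-4), Complex (-2) 4, Complex 2 (-4), Complex 2 4}, {Complex (-4) 0, Complex 4 0}}"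
    by simp
qed

lemma connects_Omega4_right:
  "connects (right_side Omega4)
     {{Complex (-2) (-4), Complex (-2) 4, Complex 2 (-4), Complex 2 4}, {Complex (-4) 0, Complex 4 0}}"
proof (rule connectsI)
  let ?L = "right_side Omega4"
  let ?Ps =
    "[[[(-2, 4), (2, -4)],
        [(-2, -4), (2, 4)]],
       [[(-4, 0), (-3, 2), (3, 2), (4, 0)]]]"
  show "curve ?L = (\<Union>p \<in> set (concat ?Ps). polyline p)"
    "\<forall>p \<in> set (concat ?Ps). \<forall>(a, b) \<in> set p. Complex a b \<in> disk"
    "crossings ?L \<subseteq> disk_interior"
    by (auto simp: strand_NW_SE_def strand_SW_NE_def H_above_def
        disk_def disk_interior_def in_cbox_complex_iff in_box_complex_iff)
  show "sorted_wrt (separate ?L) ?Ps"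
    by (auto simp: separate_def in_segment_iff complex_eq_iff)
  have m1: "meet ?L [(-2, 4), (2, -4)] [(-2, -4), (2, 4)]"
    unfolding meet_def by (rule bexI[of _ "Complex 0 0"]) (simp_all add: in_segment_iff complex_eq_iff)
  show "\<forall>ps \<in> set ?Ps. ps \<noteq> [] \<and> list_all (meet ?L (hd ps)) (tl ps)"
    using m1 by simp
  have c1: "crosses ?L (concat ?Ps) (Complex (-1) 2)
      [(-4, 0), (-3, 2), (3, 2), (4, 0)]
      [(-2, 4), (2, -4)]"
    by (auto simp: crosses_def near_def in_segment_iff complex_eq_iff
        strand_NW_SE_def strand_SW_NE_def H_above_def)
  have c2: "crosses ?L (concat ?Ps) (Complex 1 2)
      [(-4, 0), (-3, 2), (3, 2), (4, 0)]
      [(-2, -4), (2, 4)]"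
    by (auto simp: crosses_def near_def in_segment_iff complex_eq_iff
        strand_NW_SE_def strand_SW_NE_def H_above_def)
  show "\<forall>c \<in> crossings ?L. \<exists>s t. crosses ?L (concat ?Ps) c s t"
    using c1 c2 by (auto simp: zero_complex.code)
  show "(\<lambda>ps. \<Union>p \<in> set ps. polyline p - disk_interior) ` set ?Ps =
      {{Complex (-2) (-4), Complex (-2) 4, Complex 2 (-4), Complex 2 4}, {Complex (-4) 0, Complex 4 0}}"
    by (simp add: polyline_rims Un_Diff insert_commute del: polyline.simps)
  show "{} \<notin> {{Complex (-2) (-4), Complex (-2) 4, Complex 2 (-4), Complex 2 4}, {Complex (-4) 0, Complex 4 0}}"
    by simp
qed

lemma connects_Omega4'_left:
  "connects (left_side Omega4')
     {{Complex (-2) (-4), Complex (-2) 4, Complex 2 (-4), Complex 2 4}, {Complex (-4) 0, Complex 4 0}}"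
proof (rule connectsI)
  let ?L = "left_side Omega4'"
  let ?Ps =
    "[[[(-2, 4), (2, -4)],
        [(-2, -4), (2, 4)]],
       [[(-4, 0), (-3, -2), (3, -2), (4, 0)]]]"
  show "curve ?L = (\<Union>p \<in> set (concat ?Ps). polyline p)"
    "\<forall>p \<in> set (concat ?Ps). \<forall>(a, b) \<in> set p. Complex a b \<in> disk"
    "crossings ?L \<subseteq> disk_interior"
    by (auto simp: strand_NW_SE_def strand_SW_NE_def H_below_def
        disk_def disk_interior_def in_cbox_complex_iff in_box_complex_iff)
  show "sorted_wrt (separate ?L) ?Ps"
    by (auto simp: separate_def in_segment_iff complex_eq_iff)
  have m1: "meet ?L [(-2, 4), (2, -4)] [(-2, -4), (2, 4)]"
    unfolding meet_def by (rule bexI[of _ "Complex 0 0"]) (simp_all add: in_segment_iff complex_eq_iff)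
  show "\<forall>ps \<in> set ?Ps. ps \<noteq> [] \<and> list_all (meet ?L (hd ps)) (tl ps)"
    using m1 by simp
  have c1: "crosses ?L (concat ?Ps) (Complex (-1) (-2))
      [(-2, -4), (2, 4)]
      [(-4, 0), (-3, -2), (3, -2), (4, 0)]"
    by (auto simp: crosses_def near_def in_segment_iff complex_eq_iff
        strand_NW_SE_def strand_SW_NE_def H_below_def)
  have c2: "crosses ?L (concat ?Ps) (Complex 1 (-2))
      [(-2, 4), (2, -4)]
      [(-4, 0), (-3, -2), (3, -2), (4, 0)]"
    by (auto simp: crosses_def near_def in_segment_iff complex_eq_iff
        strand_NW_SE_def strand_SW_NE_def H_below_def)
  show "\<forall>c \<in> crossings ?L. \<exists>s t. crosses ?L (concat ?Ps) c s t"
    using c1 c2 by (auto simp: zero_complex.code)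
  show "(\<lambda>ps. \<Union>p \<in> set ps. polyline p - disk_interior) ` set ?Ps =
      {{Complex (-2) (-4), Complex (-2) 4, Complex 2 (-4), Complex 2 4}, {Complex (-4) 0, Complex 4 0}}"
    by (simp add: polyline_rims Un_Diff insert_commute del: polyline.simps)
  show "{} \<notin> {{Complex (-2) (-4), Complex (-2) 4, Complex 2 (-4), Complex 2 4}, {Complex (-4) 0, Complex 4 0}}"
    by simp
qed

lemma connects_Omega4'_right:
  "connects (right_side Omega4')
     {{Complex (-2) (-4), Complex (-2) 4, Complex 2 (-4), Complex 2 4}, {Complex (-4) 0, Complex 4 0}}"
proof (rule connectsI)
  let ?L = "right_side Omega4'"
  let ?Ps =
    "[[[(-2, 4), (2, -4)],
        [(-2, -4), (2, 4)]],
       [[(-4, 0), (-3, 2), (3, 2), (4, 0)]]]"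
  show "curve ?L = (\<Union>p \<in> set (concat ?Ps). polyline p)"
    "\<forall>p \<in> set (concat ?Ps). \<forall>(a, b) \<in> set p. Complex a b \<in> disk"
    "crossings ?L \<subseteq> disk_interior"
    by (auto simp: strand_NW_SE_def strand_SW_NE_def H_above_def
        disk_def disk_interior_def in_cbox_complex_iff in_box_complex_iff)
  show "sorted_wrt (separate ?L) ?Ps"
    by (auto simp: separate_def in_segment_iff complex_eq_iff)
  have m1: "meet ?L [(-2, 4), (2, -4)] [(-2, -4), (2, 4)]"
    unfolding meet_def by (rule bexI[of _ "Complex 0 0"]) (simp_all add: in_segment_iff complex_eq_iff)
  show "\<forall>ps \<in> set ?Ps. ps \<noteq> [] \<and> list_all (meet ?L (hd ps)) (tl ps)"
    using m1 by simp
  have c1: "crosses ?L (concat ?Ps) (Complex (-1) 2)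
      [(-2, 4), (2, -4)]
      [(-4, 0), (-3, 2), (3, 2), (4, 0)]"
    by (auto simp: crosses_def near_def in_segment_iff complex_eq_iff
        strand_NW_SE_def strand_SW_NE_def H_above_def)
  have c2: "crosses ?L (concat ?Ps) (Complex 1 2)
      [(-2, -4), (2, 4)]
      [(-4, 0), (-3, 2), (3, 2), (4, 0)]"
    by (auto simp: crosses_def near_def in_segment_iff complex_eq_iff
        strand_NW_SE_def strand_SW_NE_def H_above_def)
  show "\<forall>c \<in> crossings ?L. \<exists>s t. crosses ?L (concat ?Ps) c s t"
    using c1 c2 by (auto simp: zero_complex.code)
  show "(\<lambda>ps. \<Union>p \<in> set ps. polyline p - disk_interior) ` set ?Ps =
      {{Complex (-2) (-4), Complex (-2) 4, Complex 2 (-4), Complex 2 4}, {Complex (-4) 0, Complex 4 0}}"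
    by (simp add: polyline_rims Un_Diff insert_commute del: polyline.simps)
  show "{} \<notin> {{Complex (-2) (-4), Complex (-2) 4, Complex 2 (-4), Complex 2 4}, {Complex (-4) 0, Complex 4 0}}"
    by simp
qed

text \<open>
  The vertex ties the two strands together, so the four boundary points form a single class,
  wherever on the chain the crossing sits.
\<close>
lemma connects_Omega5_left:
  "connects (left_side Omega5)
     {{Complex (-4) (-2), Complex (-4) 2, Complex 4 (-2), Complex 4 2}}"
proof (rule connectsI)
  let ?L = "left_side Omega5"
  let ?Ps =
    "[[[(-4, 2), (0, -2), (4, 2)],
        [(-4, -2), (0, 2), (4, -2)]]]"
  show "curve ?L = (\<Union>p \<in> set (concat ?Ps). polyline p)"
    "\<forall>p \<in> set (concat ?Ps). \<forall>(a, b) \<in> set p. Complex a b \<in> disk"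
    "crossings ?L \<subseteq> disk_interior"
    by (auto simp: chain_def
        disk_def disk_interior_def in_cbox_complex_iff in_box_complex_iff)
  show "sorted_wrt (separate ?L) ?Ps" by simp
  have m1: "meet ?L [(-4, 2), (0, -2), (4, 2)] [(-4, -2), (0, 2), (4, -2)]"
    unfolding meet_def by (rule bexI[of _ "Complex 2 0"]) (simp_all add: in_segment_iff complex_eq_iff)
  show "\<forall>ps \<in> set ?Ps. ps \<noteq> [] \<and> list_all (meet ?L (hd ps)) (tl ps)"
    using m1 by simp
  have c1: "crosses ?L (concat ?Ps) (Complex (-2) 0)
      [(-4, -2), (0, 2), (4, -2)]
      [(-4, 2), (0, -2), (4, 2)]"
    by (auto simp: crosses_def near_def in_segment_iff complex_eq_iff)
  show "\<forall>c \<in> crossings ?L. \<exists>s t. crosses ?L (concat ?Ps) c s t"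
    using c1 by (auto simp: zero_complex.code)
  show "(\<lambda>ps. \<Union>p \<in> set ps. polyline p - disk_interior) ` set ?Ps =
      {{Complex (-4) (-2), Complex (-4) 2, Complex 4 (-2), Complex 4 2}}"
    by (simp add: polyline_rims Un_Diff insert_commute del: polyline.simps)
  show "{} \<notin> {{Complex (-4) (-2), Complex (-4) 2, Complex 4 (-2), Complex 4 2}}"
    by simp
qed

lemma connects_Omega5_right:
  "connects (right_side Omega5)
     {{Complex (-4) (-2), Complex (-4) 2, Complex 4 (-2), Complex 4 2}}"
proof (rule connectsI)
  let ?L = "right_side Omega5"
  let ?Ps =
    "[[[(-4, 2), (0, -2), (4, 2)],
        [(-4, -2), (0, 2), (4, -2)]]]"
  show "curve ?L = (\<Union>p \<in> set (concat ?Ps). polyline p)"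
    "\<forall>p \<in> set (concat ?Ps). \<forall>(a, b) \<in> set p. Complex a b \<in> disk"
    "crossings ?L \<subseteq> disk_interior"
    by (auto simp: chain_def
        disk_def disk_interior_def in_cbox_complex_iff in_box_complex_iff)
  show "sorted_wrt (separate ?L) ?Ps" by simp
  have m1: "meet ?L [(-4, 2), (0, -2), (4, 2)] [(-4, -2), (0, 2), (4, -2)]"
    unfolding meet_def by (rule bexI[of _ "Complex (-2) 0"]) (simp_all add: in_segment_iff complex_eq_iff)
  show "\<forall>ps \<in> set ?Ps. ps \<noteq> [] \<and> list_all (meet ?L (hd ps)) (tl ps)"
    using m1 by simp
  have c1: "crosses ?L (concat ?Ps) (Complex 2 0)
      [(-4, 2), (0, -2), (4, 2)]
      [(-4, -2), (0, 2), (4, -2)]"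
    by (auto simp: crosses_def near_def in_segment_iff complex_eq_iff)
  show "\<forall>c \<in> crossings ?L. \<exists>s t. crosses ?L (concat ?Ps) c s t"
    using c1 by (auto simp: zero_complex.code)
  show "(\<lambda>ps. \<Union>p \<in> set ps. polyline p - disk_interior) ` set ?Ps =
      {{Complex (-4) (-2), Complex (-4) 2, Complex 4 (-2), Complex 4 2}}"
    by (simp add: polyline_rims Un_Diff insert_commute del: polyline.simps)
  show "{} \<notin> {{Complex (-4) (-2), Complex (-4) 2, Complex 4 (-2), Complex 4 2}}"
    by simp
qed

text \<open>
  With a vertex in place of the crossing the kink is connected, so it joins its two boundary points
  whatever the direction of the marker.
\<close>
lemma connects_kink:
  assumes "curve L = kink" "crossings L = {}"
  shows "connects L {{Complex (-4) (-2), Complex (-4) 2}}"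
proof (rule connectsI)
  let ?L = L
  let ?Ps =
    "[[[(2, -1), (2, 1)],
        [(-4, 2), (2, -1)],
        [(2, 1), (-4, -2)]]]"
  show "curve ?L = (\<Union>p \<in> set (concat ?Ps). polyline p)"
    "\<forall>p \<in> set (concat ?Ps). \<forall>(a, b) \<in> set p. Complex a b \<in> disk"
    "crossings ?L \<subseteq> disk_interior"
    by (auto simp: assms kink_def
        disk_def disk_interior_def in_cbox_complex_iff in_box_complex_iff)
  show "sorted_wrt (separate ?L) ?Ps" by simp
  have m1: "meet ?L [(2, -1), (2, 1)] [(-4, 2), (2, -1)]"
    unfolding meet_def by (rule bexI[of _ "Complex 2 (-1)"]) (simp_all add: assms in_segment_iff complex_eq_iff)
  have m2: "meet ?L [(2, -1), (2, 1)] [(2, 1), (-4, -2)]"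
    unfolding meet_def by (rule bexI[of _ "Complex 2 1"]) (simp_all add: assms in_segment_iff complex_eq_iff)
  show "\<forall>ps \<in> set ?Ps. ps \<noteq> [] \<and> list_all (meet ?L (hd ps)) (tl ps)"
    using m1 m2 by simp
  show "\<forall>c \<in> crossings ?L. \<exists>s t. crosses ?L (concat ?Ps) c s t"
    by (simp add: assms)
  show "(\<lambda>ps. \<Union>p \<in> set ps. polyline p - disk_interior) ` set ?Ps =
      {{Complex (-4) (-2), Complex (-4) 2}}"
    by (simp add: polyline_rims Un_Diff insert_commute del: polyline.simps)
  show "{} \<notin> {{Complex (-4) (-2), Complex (-4) 2}}"
    by simp
qed

text \<open>
  On both sides one strand runs through both vertices and meets the other two there, so that the
  six boundary points form a single class.
\<close>
lemma connects_Omega7_left: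
  "connects (left_side Omega7)
     {{Complex (-2) (-4), Complex (-2) 4, Complex 0 (-4), Complex 0 4, Complex 2 (-4), Complex 2 4}}"
proof (rule connectsI)
  let ?L = "left_side Omega7"
  let ?Ps =
    "[[[(-2, -4), (-2, -2), (2, 2), (2, 4)],
        [(-2, 4), (-2, 0), (0, -2), (0, -4)],
        [(0, 4), (0, 2), (2, 0), (2, -4)]]]"
  show "curve ?L = (\<Union>p \<in> set (concat ?Ps). polyline p)"
    "\<forall>p \<in> set (concat ?Ps). \<forall>(a, b) \<in> set p. Complex a b \<in> disk"
    "crossings ?L \<subseteq> disk_interior"
    by (auto simp:
        disk_def disk_interior_def in_cbox_complex_iff in_box_complex_iff)
  show "sorted_wrt (separate ?L) ?Ps" by simp
  have m1: "meet ?L [(-2, -4), (-2, -2), (2, 2), (2, 4)] [(-2, 4), (-2, 0), (0, -2), (0, -4)]"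
    unfolding meet_def by (rule bexI[of _ "Complex (-1) (-1)"]) (simp_all add: in_segment_iff complex_eq_iff)
  have m2: "meet ?L [(-2, -4), (-2, -2), (2, 2), (2, 4)] [(0, 4), (0, 2), (2, 0), (2, -4)]"
    unfolding meet_def by (rule bexI[of _ "Complex 1 1"]) (simp_all add: in_segment_iff complex_eq_iff)
  show "\<forall>ps \<in> set ?Ps. ps \<noteq> [] \<and> list_all (meet ?L (hd ps)) (tl ps)"
    using m1 m2 by simp
  show "\<forall>c \<in> crossings ?L. \<exists>s t. crosses ?L (concat ?Ps) c s t"
    by simp
  show "(\<lambda>ps. \<Union>p \<in> set ps. polyline p - disk_interior) ` set ?Ps =
      {{Complex (-2) (-4), Complex (-2) 4, Complex 0 (-4), Complex 0 4, Complex 2 (-4), Complex 2 4}}"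
    by (simp add: polyline_rims Un_Diff insert_commute del: polyline.simps)
  show "{} \<notin> {{Complex (-2) (-4), Complex (-2) 4, Complex 0 (-4), Complex 0 4, Complex 2 (-4), Complex 2 4}}"
    by simp
qed

lemma connects_Omega7_right:
  "connects (right_side Omega7)
     {{Complex (-2) (-4), Complex (-2) 4, Complex 0 (-4), Complex 0 4, Complex 2 (-4), Complex 2 4}}"
proof (rule connectsI)
  let ?L = "right_side Omega7"
  let ?Ps =
    "[[[(-2, 4), (-2, 2), (2, -2), (2, -4)],
        [(-2, -4), (-2, 0), (0, 2), (0, 4)],
        [(0, -4), (0, -2), (2, 0), (2, 4)]]]"
  show "curve ?L = (\<Union>p \<in> set (concat ?Ps). polyline p)"
    "\<forall>p \<in> set (concat ?Ps). \<forall>(a, b) \<in> set p. Complex a b \<in> disk"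
    "crossings ?L \<subseteq> disk_interior"
    by (auto simp:
        disk_def disk_interior_def in_cbox_complex_iff in_box_complex_iff)
  show "sorted_wrt (separate ?L) ?Ps" by simp
  have m1: "meet ?L [(-2, 4), (-2, 2), (2, -2), (2, -4)] [(-2, -4), (-2, 0), (0, 2), (0, 4)]"
    unfolding meet_def by (rule bexI[of _ "Complex (-1) 1"]) (simp_all add: in_segment_iff complex_eq_iff)
  have m2: "meet ?L [(-2, 4), (-2, 2), (2, -2), (2, -4)] [(0, -4), (0, -2), (2, 0), (2, 4)]"
    unfolding meet_def by (rule bexI[of _ "Complex 1 (-1)"]) (simp_all add: in_segment_iff complex_eq_iff)
  show "\<forall>ps \<in> set ?Ps. ps \<noteq> [] \<and> list_all (meet ?L (hd ps)) (tl ps)"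
    using m1 m2 by simp
  show "\<forall>c \<in> crossings ?L. \<exists>s t. crosses ?L (concat ?Ps) c s t"
    by simp
  show "(\<lambda>ps. \<Union>p \<in> set ps. polyline p - disk_interior) ` set ?Ps =
      {{Complex (-2) (-4), Complex (-2) 4, Complex 0 (-4), Complex 0 4, Complex 2 (-4), Complex 2 4}}"
    by (simp add: polyline_rims Un_Diff insert_commute del: polyline.simps)
  show "{} \<notin> {{Complex (-2) (-4), Complex (-2) 4, Complex 0 (-4), Complex 0 4, Complex 2 (-4), Complex 2 4}}"
    by simp
qed

text \<open>
  Each vertex ties its two strands together. Both sides have the same curve, and the classes do not
  change when over- and under-strands are exchanged.
\<close>
lemma connects_Omega8_left:
  "connects (left_side Omega8)
     {{Complex (-3) 4, Complex (-1) 4, Complex 1 (-4), Complex 3 (-4)}, {Complex (-3) (-4), Complex (-1) (-4), Complex 1 4, Complex 3 4}}"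
proof (rule connectsI)
  let ?L = "left_side Omega8"
  let ?Ps =
    "[[[(-3, 4), (-3, 3), (-1, 1), (-1, 0), (3, -4)],
        [(-1, 4), (-1, 3), (-3, 1), (-3, 0), (1, -4)]],
       [[(3, 4), (3, 3), (1, 1), (1, 0), (-3, -4)],
        [(1, 4), (1, 3), (3, 1), (3, 0), (-1, -4)]]]"
  show "curve ?L = (\<Union>p \<in> set (concat ?Ps). polyline p)"
    "\<forall>p \<in> set (concat ?Ps). \<forall>(a, b) \<in> set p. Complex a b \<in> disk"
    "crossings ?L \<subseteq> disk_interior"
    by (auto simp: Omega8_curve_def
        disk_def disk_interior_def in_cbox_complex_iff in_box_complex_iff)
  show "sorted_wrt (separate ?L) ?Ps"
    by (auto simp: separate_def in_segment_iff complex_eq_iff)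
  have m1: "meet ?L [(-3, 4), (-3, 3), (-1, 1), (-1, 0), (3, -4)] [(-1, 4), (-1, 3), (-3, 1), (-3, 0), (1, -4)]"
    unfolding meet_def by (rule bexI[of _ "Complex (-2) 2"]) (simp_all add: in_segment_iff complex_eq_iff)
  have m2: "meet ?L [(3, 4), (3, 3), (1, 1), (1, 0), (-3, -4)] [(1, 4), (1, 3), (3, 1), (3, 0), (-1, -4)]"
    unfolding meet_def by (rule bexI[of _ "Complex 2 2"]) (simp_all add: in_segment_iff complex_eq_iff)
  show "\<forall>ps \<in> set ?Ps. ps \<noteq> [] \<and> list_all (meet ?L (hd ps)) (tl ps)"
    using m1 m2 by simp
  have c1: "crosses ?L (concat ?Ps) (Complex 0 (-1))
      [(3, 4), (3, 3), (1, 1), (1, 0), (-3, -4)]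
      [(-3, 4), (-3, 3), (-1, 1), (-1, 0), (3, -4)]"
    by (auto simp: crosses_def near_def in_segment_iff complex_eq_iff)
  have c2: "crosses ?L (concat ?Ps) (Complex (-1) (-2))
      [(3, 4), (3, 3), (1, 1), (1, 0), (-3, -4)]
      [(-1, 4), (-1, 3), (-3, 1), (-3, 0), (1, -4)]"
    by (auto simp: crosses_def near_def in_segment_iff complex_eq_iff)
  have c3: "crosses ?L (concat ?Ps) (Complex 1 (-2))
      [(1, 4), (1, 3), (3, 1), (3, 0), (-1, -4)]
      [(-3, 4), (-3, 3), (-1, 1), (-1, 0), (3, -4)]"
    by (auto simp: crosses_def near_def in_segment_iff complex_eq_iff)
  have c4: "crosses ?L (concat ?Ps) (Complex 0 (-3))
      [(1, 4), (1, 3), (3, 1), (3, 0), (-1, -4)]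
      [(-1, 4), (-1, 3), (-3, 1), (-3, 0), (1, -4)]"
    by (auto simp: crosses_def near_def in_segment_iff complex_eq_iff)
  show "\<forall>c \<in> crossings ?L. \<exists>s t. crosses ?L (concat ?Ps) c s t"
    using c1 c2 c3 c4 by (auto simp: zero_complex.code)
  show "(\<lambda>ps. \<Union>p \<in> set ps. polyline p - disk_interior) ` set ?Ps =
      {{Complex (-3) 4, Complex (-1) 4, Complex 1 (-4), Complex 3 (-4)}, {Complex (-3) (-4), Complex (-1) (-4), Complex 1 4, Complex 3 4}}"
    by (simp add: polyline_rims Un_Diff insert_commute del: polyline.simps)
  show "{} \<notin> {{Complex (-3) 4, Complex (-1) 4, Complex 1 (-4), Complex 3 (-4)}, {Complex (-3) (-4), Complex (-1) (-4), Complex 1 4, Complex 3 4}}"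
    by simp
qed

lemma connects_Omega8_right:
  "connects (right_side Omega8)
     {{Complex (-3) 4, Complex (-1) 4, Complex 1 (-4), Complex 3 (-4)}, {Complex (-3) (-4), Complex (-1) (-4), Complex 1 4, Complex 3 4}}"
proof (rule connectsI)
  let ?L = "right_side Omega8"
  let ?Ps =
    "[[[(-3, 4), (-3, 3), (-1, 1), (-1, 0), (3, -4)],
        [(-1, 4), (-1, 3), (-3, 1), (-3, 0), (1, -4)]],
       [[(3, 4), (3, 3), (1, 1), (1, 0), (-3, -4)],
        [(1, 4), (1, 3), (3, 1), (3, 0), (-1, -4)]]]"
  show "curve ?L = (\<Union>p \<in> set (concat ?Ps). polyline p)"
    "\<forall>p \<in> set (concat ?Ps). \<forall>(a, b) \<in> set p. Complex a b \<in> disk"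
    "crossings ?L \<subseteq> disk_interior"
    by (auto simp: Omega8_curve_def
        disk_def disk_interior_def in_cbox_complex_iff in_box_complex_iff)
  show "sorted_wrt (separate ?L) ?Ps"
    by (auto simp: separate_def in_segment_iff complex_eq_iff)
  have m1: "meet ?L [(-3, 4), (-3, 3), (-1, 1), (-1, 0), (3, -4)] [(-1, 4), (-1, 3), (-3, 1), (-3, 0), (1, -4)]"
    unfolding meet_def by (rule bexI[of _ "Complex (-2) 2"]) (simp_all add: in_segment_iff complex_eq_iff)
  have m2: "meet ?L [(3, 4), (3, 3), (1, 1), (1, 0), (-3, -4)] [(1, 4), (1, 3), (3, 1), (3, 0), (-1, -4)]"
    unfolding meet_def by (rule bexI[of _ "Complex 2 2"]) (simp_all add: in_segment_iff complex_eq_iff)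
  show "\<forall>ps \<in> set ?Ps. ps \<noteq> [] \<and> list_all (meet ?L (hd ps)) (tl ps)"
    using m1 m2 by simp
  have c1: "crosses ?L (concat ?Ps) (Complex 0 (-1))
      [(-3, 4), (-3, 3), (-1, 1), (-1, 0), (3, -4)]
      [(3, 4), (3, 3), (1, 1), (1, 0), (-3, -4)]"
    by (auto simp: crosses_def near_def in_segment_iff complex_eq_iff)
  have c2: "crosses ?L (concat ?Ps) (Complex (-1) (-2))
      [(-1, 4), (-1, 3), (-3, 1), (-3, 0), (1, -4)]
      [(3, 4), (3, 3), (1, 1), (1, 0), (-3, -4)]"
    by (auto simp: crosses_def near_def in_segment_iff complex_eq_iff)
  have c3: "crosses ?L (concat ?Ps) (Complex 1 (-2))
      [(-3, 4), (-3, 3), (-1, 1), (-1, 0), (3, -4)]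
      [(1, 4), (1, 3), (3, 1), (3, 0), (-1, -4)]"
    by (auto simp: crosses_def near_def in_segment_iff complex_eq_iff)
  have c4: "crosses ?L (concat ?Ps) (Complex 0 (-3))
      [(-1, 4), (-1, 3), (-3, 1), (-3, 0), (1, -4)]
      [(1, 4), (1, 3), (3, 1), (3, 0), (-1, -4)]"
    by (auto simp: crosses_def near_def in_segment_iff complex_eq_iff)
  show "\<forall>c \<in> crossings ?L. \<exists>s t. crosses ?L (concat ?Ps) c s t"
    using c1 c2 c3 c4 by (auto simp: zero_complex.code)
  show "(\<lambda>ps. \<Union>p \<in> set ps. polyline p - disk_interior) ` set ?Ps =
      {{Complex (-3) 4, Complex (-1) 4, Complex 1 (-4), Complex 3 (-4)}, {Complex (-3) (-4), Complex (-1) (-4), Complex 1 4, Complex 3 4}}"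
    by (simp add: polyline_rims Un_Diff insert_commute del: polyline.simps)
  show "{} \<notin> {{Complex (-3) 4, Complex (-1) 4, Complex 1 (-4), Complex 3 (-4)}, {Complex (-3) (-4), Complex (-1) (-4), Complex 1 4, Complex 3 4}}"
    by simp
qed

section \<open>Invariance under the moves\<close>

lemma same_connections:
  obtains X where "connects (left_side m) X" "connects (right_side m) X"
proof (cases m)
  case Omega1
  thus ?thesis using that connects_Omega1_left connects_simple_arc by simp
next
  case Omega2
  thus ?thesis using that connects_Omega2_left connects_Omega2_right by blast
next
  case Omega3
  thus ?thesis using that connects_Omega3_left connects_Omega3_right by blast
next
  case Omega4
  thus ?thesis using that connects_Omega4_left connects_Omega4_right by blast
next
  case Omega4'
  thus ?thesis using that connects_Omega4'_left connects_Omega4'_right by blast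
next
  case Omega5
  thus ?thesis using that connects_Omega5_left connects_Omega5_right by blast
next
  case Omega6
  have "connects (left_side Omega6) {{Complex (-4) (-2), Complex (-4) 2}}"
    by (rule connects_kink) simp_all
  thus ?thesis using that connects_simple_arc Omega6 by simp
next
  case Omega6'
  have "connects (left_side Omega6') {{Complex (-4) (-2), Complex (-4) 2}}"
    by (rule connects_kink) simp_all
  thus ?thesis using that connects_simple_arc Omega6' by simp
next
  case Omega7
  thus ?thesis using that connects_Omega7_left connects_Omega7_right by blast
next
  case Omega8
  thus ?thesis using that connects_Omega8_left connects_Omega8_right by blast
qed

theorem theorem4p5:
  fixes D D' :: diagram and m :: yoshikawa
  assumes "marked_graph_diagram D"
    and "marked_graph_diagram D'"
    and "yoshikawa_move m D D'"
  shows "S_prime D' = S_prime D"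
proof -
  obtain X where X: "connects (left_side m) X" "connects (right_side m) X"
    by (rule same_connections)
  have "card {f. colouring D f} = card {f. colouring D' f}"
    using assms(3) card_colourings_replaces[OF X] card_colourings_replaces[OF X(2,1)]
    unfolding yoshikawa_move_def by blast
  thus ?thesis
    using S_prime_eq_card_colourings[OF assms(1)] S_prime_eq_card_colourings[OF assms(2)] by simp
qed

end
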